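(* Let $H_1,H_2$ be complex Hilbert spaces. Then $\overline{\mathcal{AN}(H_1,H_2)}=\overline{\mathcal{AM}(H_1,H_2)}$.
   Context: Hilbert spaces are complex, of arbitrary dimension. $\mathcal{B}(H_1,H_2)$ is the space of bounded linear operators with the operator norm, and $\overline{\mathcal{A}}$ denotes the closure of $\mathcal{A}\subseteq\mathcal{B}(H_1,H_2)$ in the operator norm. $T\in\mathcal{B}(H_1,H_2)$ is norm attaining if there is $x\in H_1$ with $\|x\|=1$ and $\|Tx\|=\|T\|$; it is minimum attaining if there is $x\in H_1$ with $\|x\|=1$ and $\|Tx\|=m(T)$, where $m(T)=\inf\{\|Tx\|:x\in H_1,\|x\|=1\}$. $T$ is absolutely norm attaining (resp. absolutely minimum attaining) if for every nonzero closed subspace $M$ of $H_1$ the restriction $T|_M:M\to H_2$ is norm attaining (resp. minimum attaining). $\mathcal{AN}(H_1,H_2)$ and $\mathcal{AM}(H_1,H_2)$ are the sets of absolutely norm attaining and absolutely minimum attaining operators, respectively. *)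

theory Defs
  imports "HOL-Analysis.Analysis"
begin

class complex_vector = real_vector +
  fixes scaleC :: "complex \<Rightarrow> 'a \<Rightarrow> 'a"
  assumes scaleC_add_right: "scaleC a (x + y) = scaleC a x + scaleC a y"
    and scaleC_add_left: "scaleC (a + b) x = scaleC a x + scaleC b x"
    and scaleC_scaleC: "scaleC a (scaleC b x) = scaleC (a * b) x"
    and scaleC_one: "scaleC 1 x = x"
    and scaleR_scaleC: "scaleR r x = scaleC (complex_of_real r) x"

global_interpretation complex_vector:
  vector_space "scaleC :: complex \<Rightarrow> 'a \<Rightarrow> 'a::complex_vector"
  by unfold_locales
    (simp_all add: scaleC_add_right scaleC_add_left scaleC_scaleC scaleC_one)

text \<open>
  The real inner product is the real part of the complex one, so the norm inherited from
  \<^class>\<open>real_inner\<close> is the Hilbert space norm and positive definiteness of \<open>cinner\<close> is inherited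
  as well (see \<open>cinner_self\<close> below). The form is linear in its first argument.
\<close>

class complex_inner = complex_vector + real_inner +
  fixes cinner :: "'a \<Rightarrow> 'a \<Rightarrow> complex"
  assumes cinner_commute: "cinner x y = cnj (cinner y x)"
    and cinner_add_left: "cinner (x + y) z = cinner x z + cinner y z"
    and cinner_scaleC_left: "cinner (scaleC a x) y = a * cinner x y"
    and inner_eq_Re_cinner: "inner x y = Re (cinner x y)"

lemma cinner_self: "cinner x x = complex_of_real ((norm x)\<^sup>2)"
proof -
  have "Im (cinner x x) = 0"
    using cinner_commute[of x x] by (metis cnj.simps(2) neg_equal_zero)
  then show ?thesis
    by (simp add: complex_eq_iff power2_norm_eq_inner inner_eq_Re_cinner)
qed

lemma norm_scaleC: "norm (scaleC a x) = cmod a * norm (x :: 'a::complex_inner)"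
proof -
  have "cinner (scaleC a x) (scaleC a x) = a * cnj a * cinner x x"
    by (metis (no_types, lifting) cinner_commute cinner_scaleC_left complex_cnj_cnj
        complex_cnj_mult mult.assoc)
  also have "\<dots> = complex_of_real ((cmod a * norm x)\<^sup>2)"
    by (simp add: cinner_self complex_mult_cnj cmod_power2 power_mult_distrib)
  finally have "(norm (scaleC a x))\<^sup>2 = (cmod a * norm x)\<^sup>2"
    by (simp only: cinner_self of_real_eq_iff)
  then show ?thesis
    by (simp add: power2_eq_iff_nonneg)
qed

class chilbert_space = complex_inner + complete_space

instantiation complex :: chilbert_space
begin
definition "scaleC_complex = (\<lambda>a x :: complex. a * x)"
definition "cinner_complex = (\<lambda>x y. x * cnj y)"
instance
  by standard
    (auto simp: scaleC_complex_def cinner_complex_def algebra_simps scaleR_conv_of_real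
      inner_complex_def)
end

text \<open>
  \<^typ>\<open>'a \<Rightarrow>\<^sub>L 'b\<close> consists of the bounded real-linear operators. The bounded complex-linear ones
  carry the same operator norm and form a closed subset (\<open>closed_bounded_operators\<close>), so closures
  of sets of complex-linear operators may be taken in \<^typ>\<open>'a \<Rightarrow>\<^sub>L 'b\<close>.
\<close>

definition bounded_operators :: "('a::complex_inner \<Rightarrow>\<^sub>L 'b::complex_inner) set" where
  "bounded_operators = {T. Vector_Spaces.linear scaleC scaleC (blinfun_apply T)}"

lemma bounded_operators_iff:
  "T \<in> bounded_operators \<longleftrightarrow>
    (\<forall>a x. blinfun_apply T (scaleC a x) = scaleC a (blinfun_apply T x))"
  unfolding bounded_operators_def mem_Collect_eq
  by (auto simp: linear_iff_module_hom module_hom_iff blinfun.add_right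
      complex_vector.module_axioms)

lemma closed_bounded_operators: "closed bounded_operators"
proof -
  have scale: "bounded_linear (scaleC a :: 'b \<Rightarrow> 'b::complex_inner)" for a
    by (rule bounded_linear_intro[where K = "cmod a"])
      (auto simp: scaleC_add_right scaleR_scaleC scaleC_scaleC norm_scaleC mult.commute)
  have eq: "(bounded_operators :: ('a::complex_inner \<Rightarrow>\<^sub>L 'b::complex_inner) set) =
      (\<Inter>a x. {T. blinfun_apply T (scaleC a x) = scaleC a (blinfun_apply T x)})"
    by (auto simp: bounded_operators_iff)
  show ?thesis
    unfolding eq
    by (intro closed_INT ballI closed_Collect_eq bounded_linear.continuous_on[OF scale]
        blinfun.continuous_on continuous_intros)
qed

definition closed_csubspace :: "'a::complex_inner set \<Rightarrow> bool" where
  "closed_csubspace M \<longleftrightarrow> complex_vector.subspace M \<and> closed M"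

text \<open>
  Subspaces are sets, not types, so norm and minimum modulus of the restriction of \<open>T\<close> to \<open>M\<close> are
  taken over \<open>M\<close>. The first one is \<^const>\<open>onorm\<close> with the supremum relativised to \<open>M\<close>
  (recall \<open>0 / 0 = 0\<close>).
\<close>

definition onorm_on :: "'a::complex_inner set \<Rightarrow> ('a \<Rightarrow>\<^sub>L 'b::complex_inner) \<Rightarrow> real" where
  "onorm_on M T = (SUP x\<in>M. norm (blinfun_apply T x) / norm x)"

lemma onorm_on_UNIV: "onorm_on UNIV T = norm T"
  by (simp add: onorm_on_def norm_blinfun.rep_eq onorm_def)

definition min_modulus_on :: "'a::complex_inner set \<Rightarrow> ('a \<Rightarrow>\<^sub>L 'b::complex_inner) \<Rightarrow> real" where
  "min_modulus_on M T = Inf {norm (blinfun_apply T x) | x. x \<in> M \<and> norm x = 1}"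

definition norm_attaining_on :: "'a::complex_inner set \<Rightarrow> ('a \<Rightarrow>\<^sub>L 'b::complex_inner) \<Rightarrow> bool" where
  "norm_attaining_on M T \<longleftrightarrow>
    (\<exists>x\<in>M. norm x = 1 \<and> norm (blinfun_apply T x) = onorm_on M T)"

definition minimum_attaining_on :: "'a::complex_inner set \<Rightarrow> ('a \<Rightarrow>\<^sub>L 'b::complex_inner) \<Rightarrow> bool" where
  "minimum_attaining_on M T \<longleftrightarrow>
    (\<exists>x\<in>M. norm x = 1 \<and> norm (blinfun_apply T x) = min_modulus_on M T)"

definition AN :: "('a::complex_inner \<Rightarrow>\<^sub>L 'b::complex_inner) set" where
  "AN = {T \<in> bounded_operators.
    \<forall>M. closed_csubspace M \<and> M \<noteq> {0} \<longrightarrow> norm_attaining_on M T}"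

definition AM :: "('a::complex_inner \<Rightarrow>\<^sub>L 'b::complex_inner) set" where
  "AM = {T \<in> bounded_operators.
    \<forall>M. closed_csubspace M \<and> M \<noteq> {0} \<longrightarrow> minimum_attaining_on M T}"

end

theory Submission imports Defs begin

text \<open>
  Both closures equal the closure of the set \<open>Q\<close> of operators \<open>S\<close> with \<open>\<parallel>S x\<parallel> = \<alpha> \<parallel>x\<parallel>\<close> for all \<open>x\<close> in
  some subspace of finite codimension. Up to finite rank, \<open>S\<^sup>* S\<close> is then \<open>\<alpha>\<^sup>2\<close>, so on each closed
  subspace the extrema of \<open>\<parallel>S x\<parallel>\<close> are those over a compact sphere and the number \<open>\<alpha>\<close>; hence \<open>Q\<close> is
  contained in both sets. Conversely, call \<open>T\<close> essentially isometric if for some \<open>\<alpha>\<close> and every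
  \<open>\<epsilon> > 0\<close> we have \<open>\<bar>\<parallel>T x\<parallel> - \<alpha> \<parallel>x\<parallel>\<bar> \<le> \<epsilon> \<parallel>x\<parallel>\<close> on a subspace of finite codimension. If \<open>T\<close> is not,
  then the values \<open>\<parallel>T x\<parallel>\<close> on the unit spheres of all these subspaces contain a common open interval.
  One can therefore choose orthonormal \<open>e\<^sub>n\<close> with orthogonal images whose norms converge strictly
  monotonically, and on their closed span \<open>T\<close> does not attain its norm (or its minimum modulus).
  Finally, an essentially isometric \<open>T\<close> is a limit of elements of \<open>Q\<close>: the isometric factor of the
  polar decomposition of \<open>T / \<alpha>\<close> on a subspace of finite codimension is close to \<open>T / \<alpha>\<close>.
\<close>

section \<open>Inner products and bounded operators\<close>

lemma cinner_zero_left [simp]: "cinner 0 y = 0"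
  using cinner_add_left[of 0 0 y] by simp

lemma cinner_minus_left [simp]: "cinner (- x) y = - cinner x y"
  using cinner_add_left[of x "- x" y] by (simp add: eq_neg_iff_add_eq_0 add.commute)

lemma cinner_diff_left: "cinner (x - y) z = cinner x z - cinner y z"
  using cinner_add_left[of x "- y" z] by simp

lemma cinner_add_right: "cinner x (y + z) = cinner x y + cinner x z"
  using cinner_add_left[of y z x] by (metis cinner_commute complex_cnj_add)

lemma cinner_zero_right [simp]: "cinner x 0 = 0"
  using cinner_add_right[of x 0 0] by simp

lemma cinner_minus_right [simp]: "cinner x (- y) = - cinner x y"
  using cinner_add_right[of x y "- y"] by (simp add: eq_neg_iff_add_eq_0 add.commute)

lemma cinner_diff_right: "cinner x (y - z) = cinner x y - cinner x z"
  using cinner_add_right[of x y "- z"] by simp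

lemma cinner_scaleC_right: "cinner x (scaleC a y) = cnj a * cinner x y"
  by (metis cinner_commute cinner_scaleC_left complex_cnj_mult)

lemma cinner_scaleR_left: "cinner (r *\<^sub>R x) y = of_real r * cinner x y"
  by (simp add: scaleR_scaleC cinner_scaleC_left)

lemma cinner_scaleR_right: "cinner x (r *\<^sub>R y) = of_real r * cinner x y"
  by (simp add: scaleR_scaleC cinner_scaleC_right)

lemma cinner_eq_zero_sym: "cinner x y = 0 \<longleftrightarrow> cinner y x = 0"
  by (metis cinner_commute complex_cnj_zero)

lemma cinner_self_eq_zero [simp]: "cinner x x = 0 \<longleftrightarrow> x = 0"
  by (simp add: cinner_self)

lemma cinner_eq_zeroD: "cinner x y = 0 \<Longrightarrow> inner x y = 0"
  by (simp add: inner_eq_Re_cinner)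

text \<open>Rotating \<open>x\<close> by the unimodular scalar \<open>u\<close> makes the complex
  inner product real and nonnegative, which reduces the claim to the real Cauchy-Schwarz
  inequality.\<close>

lemma cmod_cinner_le: "cmod (cinner x y) \<le> norm x * norm y"
proof (cases "cinner x y = 0")
  case False
  define u where "u = cnj (sgn (cinner x y))"
  have "u * cinner x y = cinner x y * cnj (cinner x y) / of_real (cmod (cinner x y))"
    by (simp add: u_def sgn_eq)
  also have "\<dots> = of_real (cmod (cinner x y))"
    using False by (simp add: complex_norm_square[symmetric] power2_eq_square)
  finally have "inner (scaleC u x) y = cmod (cinner x y)"
    by (simp add: inner_eq_Re_cinner cinner_scaleC_left)
  moreover have "norm (scaleC u x) = norm x"
    using False by (simp add: norm_scaleC u_def norm_sgn)
  ultimately show ?thesis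
    using norm_cauchy_schwarz[of "scaleC u x" y] by simp
qed auto

lemma bounded_linear_scaleC: "bounded_linear (scaleC a :: 'a \<Rightarrow> 'a::complex_inner)"
  by (rule bounded_linear_intro[where K = "cmod a"])
    (auto simp: scaleC_add_right scaleR_scaleC scaleC_scaleC norm_scaleC mult.commute)

lemma bounded_linear_scaleC_left: "bounded_linear (\<lambda>a. scaleC a (x :: 'a::complex_inner))"
  by (rule bounded_linear_intro[where K = "norm x"])
    (simp_all add: scaleC_add_left scaleR_scaleC[where 'a = 'a] scaleC_scaleC norm_scaleC
      scaleR_conv_of_real)

lemma bounded_linear_cinner_left: "bounded_linear (\<lambda>x. cinner x y)"
  by (rule bounded_linear_intro[where K = "norm y"])
    (auto simp: cinner_add_left cinner_scaleR_left scaleR_conv_of_real cmod_cinner_le)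

lemma cinner_ext:
  assumes "\<And>x. cinner x a = cinner x b"
  shows "a = b"
  using assms[of "a - b"] by (metis cinner_diff_right cinner_self_eq_zero eq_iff_diff_eq_0)

text \<open>The imaginary part of \<open>cinner w m\<close> is the real inner product of
  \<open>w\<close> with \<open>scaleC \<i> m\<close>.\<close>

lemma cinner_eq_zero_if_inner:
  assumes "inner w m = 0" "inner w (scaleC \<i> m) = 0"
  shows "cinner w m = 0"
  using assms by (simp add: inner_eq_Re_cinner cinner_scaleC_right complex_eq_iff)

lemma norm_add_orth:
  assumes "inner x y = 0"
  shows "(norm (x + y))\<^sup>2 = (norm x)\<^sup>2 + (norm y)\<^sup>2"
  using assms by (simp add: power2_norm_eq_inner inner_add_left inner_add_right inner_commute)

lemma norm_diff_squared: "(norm (x - y))\<^sup>2 = (norm x)\<^sup>2 - 2 * inner x y + (norm y)\<^sup>2"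
  by (simp add: power2_norm_eq_inner inner_diff_left inner_diff_right inner_commute[of y x])

lemma norm_parallelogram:
  "(norm (x - y))\<^sup>2 + (norm (x + y))\<^sup>2 = 2 * (norm x)\<^sup>2 + 2 * (norm (y :: 'a::real_inner))\<^sup>2"
  using norm_diff_squared[of x y] norm_diff_squared[of x "- y"] by simp

lemma bounded_operators_scaleC:
  "T \<in> bounded_operators \<Longrightarrow> blinfun_apply T (scaleC a x) = scaleC a (blinfun_apply T x)"
  by (simp add: bounded_operators_iff)

lemma scaleC_scaleR_commute: "scaleC a (r *\<^sub>R x) = r *\<^sub>R scaleC a x"
  by (simp add: scaleR_scaleC scaleC_scaleC mult.commute)

lemma bounded_operators_diff:
  "S \<in> bounded_operators \<Longrightarrow> T \<in> bounded_operators \<Longrightarrow> S - T \<in> bounded_operators"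
  by (simp add: bounded_operators_iff blinfun.diff_left complex_vector.scale_right_diff_distrib)

lemma bounded_operators_scaleR:
  "T \<in> bounded_operators \<Longrightarrow> r *\<^sub>R T \<in> bounded_operators"
  by (simp add: bounded_operators_iff blinfun.scaleR_left scaleC_scaleR_commute)

lemma bounded_operators_compose:
  "S \<in> bounded_operators \<Longrightarrow> T \<in> bounded_operators \<Longrightarrow> S o\<^sub>L T \<in> bounded_operators"
  by (simp add: bounded_operators_iff)

lemma bounded_operators_id: "id_blinfun \<in> bounded_operators"
  by (simp add: bounded_operators_iff)

section \<open>Orthogonal projections and adjoints\<close>

text \<open>With \<open>F\<close> finite, \<open>orth F\<close> serves throughout as the general
  closed subspace of finite codimension. Intersecting two of them amounts to uniting the finite
  sets.\<close>

definition orth :: "'a::complex_inner set \<Rightarrow> 'a set" where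
  "orth F = {x. \<forall>f\<in>F. cinner x f = 0}"

lemma closed_csubspace_orth: "closed_csubspace (orth F)"
proof -
  have "orth F = (\<Inter>f\<in>F. {x. cinner x f = 0})"
    by (auto simp: orth_def)
  moreover have "closed {x. cinner x f = 0}" for f :: 'a
    by (intro closed_Collect_eq bounded_linear.continuous_on[OF bounded_linear_cinner_left]
        continuous_intros)
  ultimately have "closed (orth F)"
    by auto
  then show ?thesis
    by (auto simp: closed_csubspace_def complex_vector.subspace_def orth_def cinner_add_left
        cinner_scaleC_left)
qed

lemma closed_csubspace_Int:
  "closed_csubspace M \<Longrightarrow> closed_csubspace N \<Longrightarrow> closed_csubspace (M \<inter> N)"
  by (auto simp: closed_csubspace_def complex_vector.subspace_inter)

lemma closed_csubspaceD:
  assumes "closed_csubspace M"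
  shows "0 \<in> M" "x \<in> M \<Longrightarrow> y \<in> M \<Longrightarrow> x + y \<in> M" "x \<in> M \<Longrightarrow> y \<in> M \<Longrightarrow> x - y \<in> M"
    "x \<in> M \<Longrightarrow> scaleC a x \<in> M" "x \<in> M \<Longrightarrow> r *\<^sub>R x \<in> M"
  using assms by (auto simp: closed_csubspace_def scaleR_scaleC complex_vector.subspace_0
      complex_vector.subspace_add complex_vector.subspace_diff complex_vector.subspace_scale)

text \<open>A minimising sequence is Cauchy by the parallelogram law, because midpoints stay in
  \<open>M\<close>.\<close>

lemma closest_point_exists:
  fixes x :: "'a::chilbert_space"
  assumes M: "closed_csubspace M"
  shows "\<exists>p\<in>M. \<forall>m\<in>M. norm (x - p) \<le> norm (x - m)"
proof -
  define d where "d = (INF m\<in>M. (norm (x - m))\<^sup>2)"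
  have bdd: "bdd_below ((\<lambda>m. (norm (x - m))\<^sup>2) ` M)"
    by (rule bdd_belowI[of _ 0]) auto
  have ne: "M \<noteq> {}"
    using closed_csubspaceD(1)[OF M] by auto
  have d_le: "d \<le> (norm (x - m))\<^sup>2" if "m \<in> M" for m
    unfolding d_def using bdd that by (rule cINF_lower)
  have "\<exists>m\<in>M. (norm (x - m))\<^sup>2 < d + inverse (real (Suc n))" for n
    using cINF_less_iff[OF ne bdd, of "d + inverse (real (Suc n))"] by (simp add: d_def)
  then obtain y where yM: "\<And>n. y n \<in> M"
    and y: "\<And>n. (norm (x - y n))\<^sup>2 < d + inverse (real (Suc n))"
    by metis
  have dist: "(norm (y m - y n))\<^sup>2 \<le> 2 * inverse (real (Suc m)) + 2 * inverse (real (Suc n))"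
    for m n
  proof -
    have "(1/2) *\<^sub>R (y m + y n) \<in> M"
      using yM closed_csubspaceD[OF M] by auto
    then have "4 * d \<le> 4 * (norm (x - (1/2) *\<^sub>R (y m + y n)))\<^sup>2"
      using d_le by auto
    also have "\<dots> = (norm ((x - y m) + (x - y n)))\<^sup>2"
    proof -
      have "(x - y m) + (x - y n) = 2 *\<^sub>R (x - (1/2) *\<^sub>R (y m + y n))"
        by (simp add: algebra_simps scaleR_2)
      then show ?thesis
        by (simp add: power_mult_distrib)
    qed
    finally have "4 * d \<le> (norm ((x - y m) + (x - y n)))\<^sup>2" .
    moreover have "(norm (y m - y n))\<^sup>2 + (norm ((x - y m) + (x - y n)))\<^sup>2
        = 2 * (norm (x - y m))\<^sup>2 + 2 * (norm (x - y n))\<^sup>2"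
      using norm_parallelogram[of "x - y m" "x - y n"] by (simp add: norm_minus_commute)
    ultimately show ?thesis
      using y[of m] y[of n] by linarith
  qed
  have "Cauchy y"
  proof (rule CauchyI)
    fix e :: real
    assume "e > 0"
    then obtain N where N: "inverse (real (Suc N)) < e\<^sup>2 / 4"
      using reals_Archimedean[of "e\<^sup>2 / 4"] by auto
    have "norm (y m - y n) < e" if "m \<ge> N" "n \<ge> N" for m n
    proof -
      have "inverse (real (Suc m)) \<le> inverse (real (Suc N))"
        "inverse (real (Suc n)) \<le> inverse (real (Suc N))"
        using that by (auto intro!: le_imp_inverse_le)
      then have "(norm (y m - y n))\<^sup>2 < e\<^sup>2"
        using dist[of m n] N by linarith
      then show ?thesis
        using \<open>e > 0\<close> by (simp add: power2_less_imp_less)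
    qed
    then show "\<exists>K. \<forall>m\<ge>K. \<forall>n\<ge>K. norm (y m - y n) < e"
      by blast
  qed
  then obtain p where p: "y \<longlonglongrightarrow> p"
    using Cauchy_convergent convergent_def by blast
  have "p \<in> M"
    using M p yM closed_sequentially unfolding closed_csubspace_def by blast
  have "(\<lambda>n. (norm (x - y n))\<^sup>2) \<longlonglongrightarrow> (norm (x - p))\<^sup>2"
    using p by (intro tendsto_intros)
  moreover have "(\<lambda>n. d + inverse (real (Suc n))) \<longlonglongrightarrow> d + 0"
    by (intro tendsto_intros LIMSEQ_inverse_real_of_nat)
  ultimately have "(norm (x - p))\<^sup>2 \<le> d"
    using y by (intro LIMSEQ_le[of "\<lambda>n. (norm (x - y n))\<^sup>2"]) (auto intro: less_imp_le)
  then have "norm (x - p) \<le> norm (x - m)" if "m \<in> M" for m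
    using d_le[OF that] by - (rule power2_le_imp_le[OF order_trans], auto)
  with \<open>p \<in> M\<close> show ?thesis
    by blast
qed

lemma projection_exists:
  fixes x :: "'a::chilbert_space"
  assumes M: "closed_csubspace M"
  shows "\<exists>p\<in>M. \<forall>m\<in>M. cinner (x - p) m = 0"
proof -
  obtain p where p: "p \<in> M" "\<And>m. m \<in> M \<Longrightarrow> norm (x - p) \<le> norm (x - m)"
    using closest_point_exists[OF M] by blast
  have real: "inner (x - p) m = 0" if m: "m \<in> M" for m
  proof (rule ccontr)
    assume nz: "inner (x - p) m \<noteq> 0"
    \<comment> \<open>This \<open>t\<close> minimises the norm of
      \<open>(x - p) - t *\<^sub>R m\<close>, so \<open>p + t *\<^sub>R m\<close> would be strictly
      closer to \<open>x\<close> than \<open>p\<close>.\<close>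
    define t where "t = inner (x - p) m / inner m m"
    have mm: "inner m m > 0"
      using nz by auto
    have "p + t *\<^sub>R m \<in> M"
      using closed_csubspaceD[OF M] p m by auto
    from p(2)[OF this] have "(norm (x - p))\<^sup>2 \<le> (norm ((x - p) - t *\<^sub>R m))\<^sup>2"
      by (simp add: diff_diff_eq)
    also have "\<dots> = (norm (x - p))\<^sup>2 - 2 * t * inner (x - p) m + t * t * inner m m"
      unfolding norm_diff_squared[of "x - p"]
      by (simp add: power_mult_distrib power2_eq_square[of t] flip: power2_norm_eq_inner)
    also have "\<dots> = (norm (x - p))\<^sup>2 - (inner (x - p) m)\<^sup>2 / inner m m"
      using mm by (simp add: t_def power2_eq_square)
    finally show False
      using mm nz by (simp add: divide_le_0_iff)
  qed
  then have "cinner (x - p) m = 0" if "m \<in> M" for m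
    using that closed_csubspaceD(4)[OF M] by (intro cinner_eq_zero_if_inner) auto
  with p show ?thesis
    by blast
qed

lemma projection_operator_exists:
  fixes M :: "'a::chilbert_space set"
  assumes M: "closed_csubspace M"
  obtains P :: "'a \<Rightarrow>\<^sub>L 'a" where "P \<in> bounded_operators" "\<And>x. P x \<in> M"
    "\<And>x m. m \<in> M \<Longrightarrow> cinner (x - P x) m = 0" "\<And>x. x \<in> M \<Longrightarrow> P x = x"
    "\<And>x. norm (P x) \<le> norm x"
proof -
  obtain p where p: "\<And>x. p x \<in> M" "\<And>x m. m \<in> M \<Longrightarrow> cinner (x - p x) m = 0"
    using projection_exists[OF M] by metis
  \<comment> \<open>Orthogonality of the residual determines the projection. Linearity follows,
    since \<open>p x + p y\<close> and \<open>scaleC a (p x)\<close> leave orthogonal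
    residuals.\<close>
  have uniq: "p x = q" if "q \<in> M" "\<And>m. m \<in> M \<Longrightarrow> cinner (x - q) m = 0" for x q
  proof -
    have "cinner (q - p x) (q - p x) = cinner (x - p x) (q - p x) - cinner (x - q) (q - p x)"
      by (simp add: cinner_diff_left)
    also have "\<dots> = 0"
      using that p closed_csubspaceD(3)[OF M] by simp
    finally show ?thesis
      by simp
  qed
  have add: "p (x + y) = p x + p y" for x y
  proof (rule uniq)
    show "cinner (x + y - (p x + p y)) m = 0" if "m \<in> M" for m
      using p(2)[OF that, of x] p(2)[OF that, of y]
      by (simp add: cinner_diff_left cinner_add_left)
  qed (rule closed_csubspaceD(2)[OF M p(1) p(1)])
  have scale: "p (scaleC a x) = scaleC a (p x)" for a x
  proof (rule uniq)
    show "cinner (scaleC a x - scaleC a (p x)) m = 0" if "m \<in> M" for m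
      using p(2)[OF that, of x] by (simp add: cinner_diff_left cinner_scaleC_left)
  qed (rule closed_csubspaceD(4)[OF M p(1)])
  have le: "norm (p x) \<le> norm x" for x
  proof -
    have "(norm (x - p x + p x))\<^sup>2 = (norm (x - p x))\<^sup>2 + (norm (p x))\<^sup>2"
      by (intro norm_add_orth cinner_eq_zeroD p)
    then show ?thesis
      by - (rule power2_le_imp_le, auto)
  qed
  have bl: "bounded_linear p"
    by (rule bounded_linear_intro[where K = 1]) (auto simp: add scale scaleR_scaleC le)
  show thesis
  proof (rule that[of "Blinfun p"])
    show "Blinfun p \<in> bounded_operators"
      by (simp add: bounded_operators_iff bounded_linear_Blinfun_apply[OF bl] scale)
    show "Blinfun p x = x" if "x \<in> M" for x
      using that by (simp add: bounded_linear_Blinfun_apply[OF bl] uniq)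
  qed (simp_all add: bounded_linear_Blinfun_apply[OF bl] p le)
qed

section \<open>Riesz representation and adjoints\<close>

lemma riesz_representation:
  fixes f :: "'a::chilbert_space \<Rightarrow> complex"
  assumes f: "bounded_linear f" "\<And>a x. f (scaleC a x) = a * f x"
  shows "\<exists>z. \<forall>x. f x = cinner x z"
proof (cases "\<forall>x. f x = 0")
  case True
  then show ?thesis
    by (intro exI[of _ 0]) auto
next
  case False
  then obtain x0 where x0: "f x0 \<noteq> 0"
    by blast
  interpret bounded_linear f by fact
  have "closed {x. f x = 0}"
    by (intro closed_Collect_eq bounded_linear.continuous_on[OF f(1)] continuous_intros)
  then have ker: "closed_csubspace {x. f x = 0}"
    by (auto simp: closed_csubspace_def complex_vector.subspace_def add f)
  obtain p where p: "f p = 0" "\<And>m. f m = 0 \<Longrightarrow> cinner (x0 - p) m = 0"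
    using projection_exists[OF ker] by blast
  define w where "w = x0 - p"
  have fw: "f w \<noteq> 0"
    using p x0 by (simp add: w_def diff)
  \<comment> \<open>The combination \<open>scaleC (f w) x - scaleC (f x) w\<close> lies in the
    kernel of \<open>f\<close>, to which \<open>w\<close> is orthogonal.\<close>
  have cx: "f x * cinner w w = f w * cinner x w" for x
  proof -
    have "f (scaleC (f w) x - scaleC (f x) w) = 0"
      by (simp add: diff f)
    then have "cinner w (scaleC (f w) x - scaleC (f x) w) = 0"
      unfolding w_def by (rule p(2))
    then have "cinner (scaleC (f w) x - scaleC (f x) w) w = 0"
      by (subst cinner_eq_zero_sym)
    then show ?thesis
      by (simp add: cinner_diff_left cinner_scaleC_left)
  qed
  have "w \<noteq> 0"
    using fw by auto
  then have "f x = cinner x (scaleC (cnj (f w / cinner w w)) w)" for x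
    using cx[of x] by (simp add: cinner_scaleC_right nonzero_eq_divide_eq)
  then show ?thesis
    by blast
qed

lemma adjoint_exists:
  fixes T :: "'a::chilbert_space \<Rightarrow>\<^sub>L 'b::chilbert_space"
  assumes T: "T \<in> bounded_operators"
  obtains A :: "'b \<Rightarrow>\<^sub>L 'a" where "A \<in> bounded_operators" "\<And>x y. cinner (T x) y = cinner x (A y)"
proof -
  have "\<exists>z. \<forall>x. cinner (T x) y = cinner x z" for y
    by (rule riesz_representation)
      (auto intro: bounded_linear_compose[OF bounded_linear_cinner_left]
        blinfun.bounded_linear_right simp: bounded_operators_scaleC[OF T] cinner_scaleC_left)
  then obtain A where A: "\<And>x y. cinner (T x) y = cinner x (A y)"
    by metis
  have add: "A (x + y) = A x + A y" for x y
    by (rule cinner_ext) (simp add: cinner_add_right flip: A)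
  have scale: "A (scaleC a x) = scaleC a (A x)" for a x
    by (rule cinner_ext) (simp add: cinner_scaleC_right flip: A)
  have le: "norm (A y) \<le> norm y * norm T" for y
  proof (cases "A y = 0")
    case False
    \<comment> \<open>The bound on \<open>A\<close> comes from testing the adjoint relation at
      \<open>x = A y\<close>.\<close>
    have "norm (A y) * norm (A y) = cmod (cinner (T (A y)) y)"
      by (simp add: A cinner_self power2_eq_square norm_mult)
    also have "\<dots> \<le> norm (T (A y)) * norm y"
      by (rule cmod_cinner_le)
    also have "\<dots> \<le> norm T * norm (A y) * norm y"
      by (intro mult_right_mono norm_blinfun) auto
    finally show ?thesis
      using False by (simp add: mult.commute mult.left_commute)
  qed auto
  have bl: "bounded_linear A"
    by (rule bounded_linear_intro[where K = "norm T"]) (auto simp: add scale scaleR_scaleC le)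
  show thesis
    by (rule that[of "Blinfun A"])
      (auto simp: bounded_operators_iff bounded_linear_Blinfun_apply[OF bl] scale A)
qed

section \<open>Finite-dimensional subspaces\<close>

lemma orth_span:
  assumes "x \<in> orth F" "y \<in> complex_vector.span F"
  shows "cinner x y = 0"
  using assms(2)
  by (rule complex_vector.span_induct)
    (use assms(1) in \<open>auto simp: complex_vector.subspace_def cinner_add_right cinner_scaleC_right
      orth_def\<close>)

text \<open>One Gram-Schmidt step per element of \<open>F\<close>. If \<open>g\<close> already
  depends on the others, then \<open>u = 0\<close> and orthogonality to \<open>u\<close> is
  trivial.\<close>

lemma span_orth_decomposition:
  assumes "finite F"
  shows "\<exists>p\<in>complex_vector.span F. x - p \<in> orth F"
  using assms
proof (induction F arbitrary: x)
  case empty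
  show ?case
    by (simp add: orth_def)
next
  case (insert g F)
  obtain pg where pg: "pg \<in> complex_vector.span F" "g - pg \<in> orth F"
    using insert.IH by blast
  obtain p where p: "p \<in> complex_vector.span F" "x - p \<in> orth F"
    using insert.IH by blast
  define u where "u = g - pg"
  define c where "c = cinner (x - p) u / cinner u u"
  define r where "r = x - p - scaleC c u"
  have "cinner r u = 0"
    by (cases "u = 0") (auto simp: r_def c_def cinner_diff_left cinner_scaleC_left)
  moreover have r: "r \<in> orth F"
    using p pg closed_csubspaceD[OF closed_csubspace_orth] unfolding r_def u_def by blast
  moreover have "cinner r pg = 0"
    using r pg by (intro orth_span)
  ultimately have "r \<in> orth (insert g F)"
    by (auto simp: orth_def u_def cinner_diff_right)
  moreover have "p + scaleC c u \<in> complex_vector.span (insert g F)"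
    using p pg unfolding u_def
    by (meson complex_vector.span_add complex_vector.span_base complex_vector.span_diff
        complex_vector.span_mono complex_vector.span_scale insertI1 subset_insertI subsetD)
  ultimately show ?case
    by (intro bexI[of _ "p + scaleC c u"]) (auto simp: r_def diff_diff_eq)
qed

text \<open>The finitely many functionals \<open>\<lambda>x. cinner x f\<close> separate the points
  of \<open>M\<close>, so \<open>M\<close> is finite-dimensional. Each induction step removes one
  functional and splits off at most a line from \<open>M\<close>.\<close>

lemma compact_Int_cball_if_separated:
  fixes M :: "'a::chilbert_space set"
  assumes "finite F" "closed_csubspace M" "M \<inter> orth F \<subseteq> {0}"
  shows "compact (M \<inter> cball 0 1)"
  using assms
proof (induction F arbitrary: M)
  case empty
  then have "M \<subseteq> {0}"
    by (simp add: orth_def)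
  then have "finite (M \<inter> cball 0 1)"
    by (meson finite.emptyI finite_Int finite_insert finite_subset)
  then show ?case
    by (rule finite_imp_compact)
next
  case (insert g F)
  define M' where "M' = M \<inter> orth {g}"
  have M': "closed_csubspace M'"
    unfolding M'_def using insert.prems closed_csubspace_orth by (intro closed_csubspace_Int)
  have "M' \<inter> orth F \<subseteq> {0}"
    using insert.prems by (auto simp: M'_def orth_def)
  then have comp: "compact (M' \<inter> cball 0 1)"
    using M' by (intro insert.IH)
  show ?case
  proof (cases "M \<subseteq> orth {g}")
    case True
    then have "M' = M"
      by (auto simp: M'_def)
    then show ?thesis
      using comp by simp
  next
    case False
    then obtain x where x: "x \<in> M" "cinner x g \<noteq> 0"
      by (auto simp: orth_def)
    obtain p where p: "p \<in> M'" "\<And>m. m \<in> M' \<Longrightarrow> cinner (x - p) m = 0"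
      using projection_exists[OF M'] by blast
    define w where "w = x - p"
    have w: "w \<in> M" "cinner w g \<noteq> 0"
      using x p closed_csubspaceD(3)[OF insert.prems(1)]
      by (auto simp: w_def M'_def orth_def cinner_diff_left)
    have "w \<noteq> 0"
      using w by auto
    \<comment> \<open>The component along \<open>w\<close> is orthogonal to \<open>M'\<close>, hence
      has norm at most 1 for vectors of the unit ball. This gives the radius of the disc of
      coefficients.\<close>
    define L where "L = (\<lambda>c. scaleC c w) ` cball 0 (1 / norm w)"
    have "compact L"
      unfolding L_def
      by (intro compact_continuous_image compact_cball
          bounded_linear.continuous_on[OF bounded_linear_scaleC_left] continuous_intros)
    then have "compact {a + b |a b. a \<in> L \<and> b \<in> M' \<inter> cball 0 1}"
      using comp by (intro compact_sums)
    moreover have "closed (M \<inter> cball 0 1)"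
      using insert.prems(1) by (auto simp: closed_csubspace_def)
    ultimately have "compact (M \<inter> cball 0 1 \<inter> {a + b |a b. a \<in> L \<and> b \<in> M' \<inter> cball 0 1})"
      by (intro closed_Int_compact)
    moreover have "M \<inter> cball 0 1 \<subseteq> {a + b |a b. a \<in> L \<and> b \<in> M' \<inter> cball 0 1}"
    proof
      fix y
      assume y: "y \<in> M \<inter> cball 0 1"
      \<comment> \<open>Chosen so that the remainder \<open>b\<close> is orthogonal to
        \<open>g\<close> and thus lies in \<open>M'\<close>.\<close>
      define c where "c = cinner y g / cinner w g"
      define b where "b = y - scaleC c w"
      have b: "b \<in> M'"
        using y w closed_csubspaceD[OF insert.prems(1)]
        by (auto simp: M'_def b_def c_def orth_def cinner_diff_left cinner_scaleC_left)
      have "cinner (scaleC c w) b = 0"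
        using p(2)[OF b] by (simp add: w_def cinner_scaleC_left)
      then have "(norm (scaleC c w + b))\<^sup>2 = (norm (scaleC c w))\<^sup>2 + (norm b)\<^sup>2"
        by (intro norm_add_orth cinner_eq_zeroD)
      then have *: "(norm y)\<^sup>2 = (norm (scaleC c w))\<^sup>2 + (norm b)\<^sup>2"
        by (simp add: b_def)
      have "norm b \<le> norm y" "norm (scaleC c w) \<le> norm y"
        by (rule power2_le_imp_le; simp add: *)+
      then have "norm b \<le> 1" "cmod c \<le> 1 / norm w"
        using y \<open>w \<noteq> 0\<close> by (auto simp: norm_scaleC field_simps)
      then show "y \<in> {a + b |a b. a \<in> L \<and> b \<in> M' \<inter> cball 0 1}"
        using b unfolding L_def
        by (intro CollectI exI[of _ "scaleC c w"] exI[of _ b]) (auto simp: b_def)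
    qed
    ultimately show ?thesis
      by (simp only: Int_absorb2)
  qed
qed

section \<open>Operators that are isometric up to a factor on a subspace of finite codimension\<close>

text \<open>The set \<open>Q\<close> of the overview.\<close>

definition finite_codim_isometric :: "('a::complex_inner \<Rightarrow>\<^sub>L 'b::complex_inner) set" where
  "finite_codim_isometric = {S \<in> bounded_operators.
    \<exists>\<alpha> F. finite F \<and> (\<forall>x\<in>orth F. norm (blinfun_apply S x) = \<alpha> * norm x)}"

text \<open>The sign \<open>s\<close> covers the maximum and the minimum of the norm simultaneously.\<close>

lemma finite_codim_isometric_extremum:
  fixes S :: "'a::chilbert_space \<Rightarrow>\<^sub>L 'b::chilbert_space" and s :: real
  assumes S: "S \<in> finite_codim_isometric" and M: "closed_csubspace M" "M \<noteq> {0}"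
  shows "\<exists>k\<in>M. norm k = 1 \<and> (\<forall>y\<in>M. s * (norm (S y))\<^sup>2 \<le> s * (norm (S k))\<^sup>2 * (norm y)\<^sup>2)"
proof -
  have bo: "S \<in> bounded_operators"
    using S by (simp add: finite_codim_isometric_def)
  obtain \<alpha> F where F: "finite F" "\<And>x. x \<in> orth F \<Longrightarrow> norm (S x) = \<alpha> * norm x"
    using S by (auto simp: finite_codim_isometric_def)
  obtain A where A: "A \<in> bounded_operators" "\<And>x y. cinner (S x) y = cinner x (blinfun_apply A y)"
    using adjoint_exists[OF bo] by blast
  \<comment> \<open>Adding the vectors \<open>A (S f)\<close> makes the image of
    \<open>orth G\<close> orthogonal to \<open>S f\<close> for all \<open>f\<close> in
    \<open>F\<close>.\<close>
  define G where "G = F \<union> (\<lambda>f. A (S f)) ` F"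
  have G: "finite G" "orth G \<subseteq> orth F"
    using F by (auto simp: G_def orth_def)
  have polar: "inner (S x) (S y) = \<alpha>\<^sup>2 * inner x y" if "x \<in> orth F" "y \<in> orth F" for x y
    using F(2)[of x] F(2)[of y] F(2)[of "x - y"] that
      closed_csubspaceD(3)[OF closed_csubspace_orth that]
      norm_diff_squared[of "S x" "S y"] norm_diff_squared[of x y]
    by (simp add: blinfun.diff_right power_mult_distrib algebra_simps)
  \<comment> \<open>On \<open>orth G\<close>, \<open>S\<^sup>* S\<close> acts as the scalar
    \<open>\<alpha>\<^sup>2\<close> even when tested against arbitrary \<open>y\<close>: the part of
    \<open>y\<close> in the span of \<open>F\<close> contributes zero to both sides, and
    \<open>polar\<close> covers the rest.\<close>
  have form: "inner (S x) (S y) = \<alpha>\<^sup>2 * inner x y" if x: "x \<in> orth G" for x y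
  proof -
    obtain p where p: "p \<in> complex_vector.span F" "y - p \<in> orth F"
      using span_orth_decomposition[OF F(1)] by blast
    have "cinner (S x) (S p) = 0"
      using p(1)
      by (rule complex_vector.span_induct)
        (use x in \<open>auto simp: complex_vector.subspace_def blinfun.add_right cinner_add_right
            bounded_operators_scaleC[OF bo]
            bounded_operators_scaleC[OF A(1)] cinner_scaleC_right G_def orth_def A(2)\<close>)
    moreover have "cinner x p = 0"
      using x p G by (intro orth_span[of _ F]) auto
    moreover have "inner (S x) (S (y - p)) = \<alpha>\<^sup>2 * inner x (y - p)"
      using x p G by (intro polar) auto
    ultimately show ?thesis
      by (auto simp: blinfun.diff_right inner_diff_right dest!: cinner_eq_zeroD)
  qed
  \<comment> \<open>\<open>S\<close> is isometric up to the factor \<open>\<alpha>\<close> on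
    \<open>M1\<close>. The complement \<open>M2\<close> of \<open>M1\<close> in \<open>M\<close>
    meets \<open>orth G\<close> only in 0, so its unit sphere is compact.\<close>
  define M1 where "M1 = M \<inter> orth G"
  define M2 where "M2 = M \<inter> orth M1"
  have M1: "closed_csubspace M1" and M2: "closed_csubspace M2"
    using M closed_csubspace_orth by (auto simp: M1_def M2_def intro: closed_csubspace_Int)
  have "M2 \<inter> orth G \<subseteq> {0}"
  proof
    fix x
    assume "x \<in> M2 \<inter> orth G"
    then have "cinner x x = 0"
      by (auto simp: M2_def M1_def orth_def)
    then show "x \<in> {0}"
      by simp
  qed
  then have "compact (M2 \<inter> cball 0 1)"
    using G M2 by (intro compact_Int_cball_if_separated)
  moreover have "closed (sphere 0 1 :: 'a set)"
    unfolding sphere_def by (intro closed_Collect_eq continuous_intros)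
  ultimately have "compact ((M2 \<inter> cball 0 1) \<inter> sphere 0 1)"
    by (rule compact_Int_closed)
  then have K2: "compact (M2 \<inter> sphere 0 1)"
    by (metis Int_assoc inf.absorb_iff2 sphere_cball)
  have sph: "(1 / norm x) *\<^sub>R x \<in> N \<inter> sphere 0 1" if "closed_csubspace N" "x \<in> N" "x \<noteq> 0"
    for x :: 'a and N
    using that closed_csubspaceD(5)[OF that(1,2)] by auto
  \<comment> \<open>All unit vectors of \<open>M1\<close> give the same value, so a single
    representative suffices; there is none if \<open>M1\<close> is trivial.\<close>
  obtain U where U: "finite U" "U \<subseteq> M1 \<inter> sphere 0 1" "M1 \<noteq> {0} \<Longrightarrow> U \<noteq> {}"
  proof (cases "M1 = {0}")
    case False
    then obtain x where "x \<in> M1" "x \<noteq> 0"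
      using closed_csubspaceD(1)[OF M1] by blast
    then show thesis
      using sph[OF M1] by (intro that[of "{(1 / norm x) *\<^sub>R x}"]) auto
  qed (use that[of "{}"] in auto)
  define K where "K = U \<union> (M2 \<inter> sphere 0 1)"
  have K: "compact K"
    unfolding K_def using compact_Un[OF finite_imp_compact[OF U(1)] K2] .
  have KM: "K \<subseteq> M \<inter> sphere 0 1"
    using U by (auto simp: K_def M1_def M2_def)
  have decomp: "\<exists>y1\<in>M1. \<exists>y2\<in>M2. y = y1 + y2" if y: "y \<in> M" for y
  proof -
    obtain y1 where "y1 \<in> M1" "\<And>m. m \<in> M1 \<Longrightarrow> cinner (y - y1) m = 0"
      using projection_exists[OF M1] by blast
    then show ?thesis
      using y closed_csubspaceD(3)[OF M(1)]
      by (intro bexI[of _ y1] bexI[of _ "y - y1"]) (auto simp: M2_def M1_def orth_def)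
  qed
  have "K \<noteq> {}"
  proof
    assume "K = {}"
    then have "M1 = {0}" "M2 \<inter> sphere 0 1 = {}"
      using U by (auto simp: K_def)
    then have "M2 \<subseteq> {0}"
      using sph[OF M2] by fastforce
    then have "M \<subseteq> {0}"
      using decomp \<open>M1 = {0}\<close> by fastforce
    then show False
      using M closed_csubspaceD(1)[OF M(1)] by blast
  qed
  moreover have "continuous_on K (\<lambda>x. s * (norm (S x))\<^sup>2)"
    by (intro continuous_intros)
  ultimately obtain k where k: "k \<in> K" "\<And>x. x \<in> K \<Longrightarrow> s * (norm (S x))\<^sup>2 \<le> s * (norm (S k))\<^sup>2"
    using continuous_attains_sup[OF K] by blast
  have part2: "s * (norm (S y))\<^sup>2 \<le> s * (norm (S k))\<^sup>2 * (norm y)\<^sup>2" if y: "y \<in> M2" for y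
  proof (cases "y = 0")
    case False
    then have "(1 / norm y) *\<^sub>R y \<in> K"
      using sph[OF M2 y] by (auto simp: K_def)
    from k(2)[OF this] show ?thesis
      using False by (simp add: blinfun.scaleR_right power_mult_distrib field_simps)
  qed auto
  have part1: "s * (norm (S y))\<^sup>2 \<le> s * (norm (S k))\<^sup>2 * (norm y)\<^sup>2" if y: "y \<in> M1" for y
  proof (cases "y = 0")
    case False
    then obtain u where u: "u \<in> U"
      using U y by fastforce
    then have "u \<in> orth F" "norm u = 1"
      using U G by (auto simp: M1_def)
    then have "(norm (S u))\<^sup>2 = \<alpha>\<^sup>2"
      using F(2)[of u] by simp
    then have "s * \<alpha>\<^sup>2 \<le> s * (norm (S k))\<^sup>2"
      using k(2)[of u] u by (simp add: K_def)
    moreover have "norm (S y) = \<alpha> * norm y"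
      using y G by (intro F) (auto simp: M1_def)
    ultimately show ?thesis
      using mult_right_mono[of "s * \<alpha>\<^sup>2" "s * (norm (S k))\<^sup>2" "(norm y)\<^sup>2"]
      by (simp add: power_mult_distrib mult.assoc)
  qed auto
  \<comment> \<open>By \<open>form\<close>, the orthogonal summands of \<open>y\<close> have
    orthogonal images, so the bounds on \<open>M1\<close> and \<open>M2\<close> add up.\<close>
  have "s * (norm (S y))\<^sup>2 \<le> s * (norm (S k))\<^sup>2 * (norm y)\<^sup>2" if y: "y \<in> M" for y
  proof -
    obtain y1 y2 where y12: "y1 \<in> M1" "y2 \<in> M2" "y = y1 + y2"
      using decomp[OF y] by blast
    then have "cinner y2 y1 = 0"
      by (auto simp: M2_def orth_def)
    then have ort: "inner y1 y2 = 0"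
      by (metis cinner_eq_zeroD inner_commute)
    moreover have "inner (S y1) (S y2) = \<alpha>\<^sup>2 * inner y1 y2"
      using y12 by (intro form) (auto simp: M1_def)
    ultimately have "(norm (S y))\<^sup>2 = (norm (S y1))\<^sup>2 + (norm (S y2))\<^sup>2"
      by (simp add: y12 blinfun.add_right norm_add_orth)
    moreover have "(norm y)\<^sup>2 = (norm y1)\<^sup>2 + (norm y2)\<^sup>2"
      using ort by (simp add: y12 norm_add_orth)
    ultimately show ?thesis
      using part1[OF y12(1)] part2[OF y12(2)] by (simp add: algebra_simps)
  qed
  moreover have "k \<in> M" "norm k = 1"
    using k(1) KM by auto
  ultimately show ?thesis
    by blast
qed

section \<open>Attainment of norm and minimum modulus for operators in \<open>Q\<close>\<close>

lemma finite_codim_isometric_subset_AN: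
  "(finite_codim_isometric :: ('a::chilbert_space \<Rightarrow>\<^sub>L 'b::chilbert_space) set) \<subseteq> AN"
proof
  fix S :: "'a \<Rightarrow>\<^sub>L 'b"
  assume S: "S \<in> finite_codim_isometric"
  have "norm_attaining_on M S" if M: "closed_csubspace M" "M \<noteq> {0}" for M
  proof -
    obtain k where k: "k \<in> M" "norm k = 1"
      and "\<And>y. y \<in> M \<Longrightarrow> 1 * (norm (S y))\<^sup>2 \<le> 1 * (norm (S k))\<^sup>2 * (norm y)\<^sup>2"
      using finite_codim_isometric_extremum[OF S M, of 1] by blast
    then have "norm (S y) \<le> norm (S k) * norm y" if "y \<in> M" for y
      using that by (intro power2_le_imp_le[of "norm (S y)"]) (auto simp: power_mult_distrib)
    then have le: "norm (S y) / norm y \<le> norm (S k)" if "y \<in> M" for y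
      using that by (cases "y = 0") (auto simp: divide_le_eq)
    have "onorm_on M S = norm (S k)"
      unfolding onorm_on_def using k le
      by (intro cSup_eq_maximum) (auto intro!: image_eqI[of _ _ k])
    then show ?thesis
      using k by (auto simp: norm_attaining_on_def)
  qed
  then show "S \<in> AN"
    using S by (simp add: AN_def finite_codim_isometric_def)
qed

lemma finite_codim_isometric_subset_AM:
  "(finite_codim_isometric :: ('a::chilbert_space \<Rightarrow>\<^sub>L 'b::chilbert_space) set) \<subseteq> AM"
proof
  fix S :: "'a \<Rightarrow>\<^sub>L 'b"
  assume S: "S \<in> finite_codim_isometric"
  have "minimum_attaining_on M S" if M: "closed_csubspace M" "M \<noteq> {0}" for M
  proof -
    obtain k where k: "k \<in> M" "norm k = 1"
      and "\<And>y. y \<in> M \<Longrightarrow> (-1) * (norm (S y))\<^sup>2 \<le> (-1) * (norm (S k))\<^sup>2 * (norm y)\<^sup>2"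
      using finite_codim_isometric_extremum[OF S M, of "-1"] by blast
    then have "norm (S k) \<le> norm (S y)" if "y \<in> M" "norm y = 1" for y
      using that by (intro power2_le_imp_le[of "norm (S k)"]) fastforce+
    then have "min_modulus_on M S = norm (S k)"
      unfolding min_modulus_on_def using k by (intro cInf_eq_minimum) auto
    then show ?thesis
      using k by (auto simp: minimum_attaining_on_def)
  qed
  then show "S \<in> AM"
    using S by (simp add: AM_def finite_codim_isometric_def)
qed

section \<open>Essentially isometric operators\<close>

text \<open>On Hilbert spaces this says that \<open>T\<^sup>* T - \<alpha>\<^sup>2\<close> is
  compact. The formulation by norms on subspaces of finite codimension avoids compact operators and
  spectral theory.\<close>

definition essentially_isometric :: "('a::complex_inner \<Rightarrow>\<^sub>L 'b::complex_inner) set" where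
  "essentially_isometric = {T \<in> bounded_operators. \<exists>\<alpha>\<ge>0. \<forall>\<epsilon>>0. \<exists>F. finite F \<and>
    (\<forall>x\<in>orth F. \<bar>norm (blinfun_apply T x) - \<alpha> * norm x\<bar> \<le> \<epsilon> * norm x)}"

section \<open>Approximation by operators isometric on a given subspace\<close>

instance chilbert_space \<subseteq> banach ..

text \<open>For a symmetric map the numerical radius bounds the norm: polarise the form at
  \<open>x\<close> and a multiple of \<open>D x\<close>.\<close>

lemma norm_le_if_quadratic_form_le:
  fixes D :: "'a::real_inner \<Rightarrow> 'a"
  assumes D: "linear D" and x: "x \<in> N" "D x \<in> N"
    and N: "\<And>x y. x \<in> N \<Longrightarrow> y \<in> N \<Longrightarrow> x + y \<in> N" "\<And>r x. x \<in> N \<Longrightarrow> r *\<^sub>R x \<in> N"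
    and sym: "\<And>x y. x \<in> N \<Longrightarrow> y \<in> N \<Longrightarrow> inner y (D x) = inner (D y) x"
    and le: "\<And>x. x \<in> N \<Longrightarrow> \<bar>inner x (D x)\<bar> \<le> \<delta> * (norm x)\<^sup>2"
  shows "norm (D x) \<le> \<delta> * norm x"
proof (cases "D x = 0")
  case True
  have "0 \<le> \<delta> * (norm x)\<^sup>2"
    using le[OF x(1)] by (rule order_trans[OF abs_ge_zero])
  then show ?thesis
    using True by (cases "x = 0") (auto simp: zero_le_mult_iff)
next
  case False
  interpret linear D by fact
  have "x \<noteq> 0"
    using False zero by auto
  \<comment> \<open>Scaling \<open>D x\<close> to the norm of \<open>x\<close> makes the
    parallelogram law give \<open>4 * (norm x)\<^sup>2\<close>.\<close>
  define y where "y = (norm x / norm (D x)) *\<^sub>R D x"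
  have y: "y \<in> N" "norm y = norm x"
    using False x N by (auto simp: y_def)
  have xy: "x + y \<in> N" "x - y \<in> N"
    using N(1)[OF x(1) y(1)] N(1)[OF x(1) N(2)[OF y(1), of "-1"]] by auto
  have "inner (x + y) (D (x + y)) - inner (x - y) (D (x - y)) = 2 * inner y (D x) + 2 * inner x (D y)"
    by (simp add: add diff inner_add_left inner_add_right inner_diff_left inner_diff_right)
  also have "inner x (D y) = inner y (D x)"
    using sym[OF y(1) x(1)] by (simp add: inner_commute)
  finally have "4 * inner y (D x) = inner (x + y) (D (x + y)) - inner (x - y) (D (x - y))"
    by simp
  also have "\<dots> \<le> \<delta> * (norm (x + y))\<^sup>2 + \<delta> * (norm (x - y))\<^sup>2"
    using le[OF xy(1)] le[OF xy(2)] by linarith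
  also have "\<dots> = \<delta> * ((norm (x - y))\<^sup>2 + (norm (x + y))\<^sup>2)"
    by (simp add: algebra_simps)
  also have "\<dots> = 4 * (\<delta> * (norm x)\<^sup>2)"
    unfolding norm_parallelogram using y by simp
  finally have "inner y (D x) \<le> \<delta> * (norm x)\<^sup>2"
    by simp
  moreover have "inner y (D x) = norm x * norm (D x)"
    using False by (simp add: y_def power2_eq_square flip: power2_norm_eq_inner)
  ultimately have "norm x * norm (D x) \<le> norm x * (\<delta> * norm x)"
    by (simp add: power2_eq_square mult.left_commute)
  then show ?thesis
    using \<open>x \<noteq> 0\<close> by simp
qed

text \<open>
  One step of the Newton--Schulz iteration for the polar decomposition: \<open>W - W D / 2\<close> with
  \<open>D = W\<^sup>* W - 1\<close>. Its defect is quadratic in that of \<open>W\<close>.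
\<close>

lemma isometry_defect_halving:
  fixes W :: "'a::chilbert_space \<Rightarrow>\<^sub>L 'b::chilbert_space"
  assumes N: "closed_csubspace N" and W: "W \<in> bounded_operators" and d: "0 \<le> d" "d \<le> 1/2"
    and defect: "\<And>x. x \<in> N \<Longrightarrow> \<bar>(norm (W x))\<^sup>2 - (norm x)\<^sup>2\<bar> \<le> d * (norm x)\<^sup>2"
  shows "\<exists>W'\<in>bounded_operators. norm (W' - W) \<le> d \<and>
    (\<forall>x\<in>N. \<bar>(norm (blinfun_apply W' x))\<^sup>2 - (norm x)\<^sup>2\<bar> \<le> d / 2 * (norm x)\<^sup>2)"
proof -
  obtain P where P: "P \<in> bounded_operators" "\<And>x. blinfun_apply P x \<in> N"
    "\<And>x m. m \<in> N \<Longrightarrow> cinner (x - P x) m = 0" "\<And>x. x \<in> N \<Longrightarrow> P x = x" "\<And>x. norm (P x) \<le> norm x"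
    using projection_operator_exists[OF N] by blast
  obtain A where A: "A \<in> bounded_operators" "\<And>x y. cinner (W x) y = cinner x (blinfun_apply A y)"
    using adjoint_exists[OF W] by blast
  \<comment> \<open>Compressing to \<open>N\<close> on both sides makes \<open>D\<close> symmetric
    on \<open>N\<close> and zero on its complement, so its bound on \<open>N\<close> holds on the
    whole space.\<close>
  define D where "D = P o\<^sub>L ((A o\<^sub>L W) - id_blinfun) o\<^sub>L P"
  have D: "D \<in> bounded_operators"
    unfolding D_def using P A W
    by (intro bounded_operators_compose bounded_operators_diff bounded_operators_id)
  have DN: "D x \<in> N" for x
    by (simp add: D_def P)
  have inner_D: "inner y (D x) = inner (W y) (W x) - inner y x" if "x \<in> N" "y \<in> N" for x y
  proof -
    define z where "z = A (W x) - x"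
    have "cinner (z - P z) y = 0"
      using that P by blast
    then have "inner y (z - P z) = 0"
      by (subst inner_commute) (rule cinner_eq_zeroD)
    then have "inner y (P z) = inner y z"
      by (simp add: inner_diff_right)
    moreover have "D x = P z"
      using that P by (simp add: D_def z_def blinfun.diff_left)
    moreover have "cinner y z = cinner (W y) (W x) - cinner y x"
      by (simp add: z_def cinner_diff_right A(2))
    ultimately show ?thesis
      by (simp add: inner_eq_Re_cinner)
  qed
  have form: "\<bar>inner x (D x)\<bar> \<le> d * (norm x)\<^sup>2" if "x \<in> N" for x
    using defect[OF that] by (simp add: inner_D that power2_norm_eq_inner)
  have norm_D: "norm (D x) \<le> d * norm x" if "x \<in> N" for x
  proof (rule norm_le_if_quadratic_form_le[of D x N d])
    show "linear D"
      by (intro bounded_linear.linear blinfun.bounded_linear_right)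
    show "inner y (D x) = inner (D y) x" if "x \<in> N" "y \<in> N" for x y
      using inner_D[of x y] inner_D[of y x] that by (simp add: inner_commute)
  qed (simp_all add: that DN form closed_csubspaceD(2,5)[OF N])
  define W' where "W' = W - (1/2) *\<^sub>R (W o\<^sub>L D)"
  have W': "W' \<in> bounded_operators"
    unfolding W'_def using W D
    by (intro bounded_operators_diff bounded_operators_scaleR bounded_operators_compose)
  have "norm (W' - W) \<le> d"
  proof (rule norm_blinfun_bound)
    fix x
    have "D x = D (P x)"
      by (simp add: D_def P)
    then have "norm (D x) \<le> d * norm (P x)"
      using norm_D P by metis
    also have "\<dots> \<le> d * norm x"
      using d P by (intro mult_left_mono)
    finally have Dx: "norm (D x) \<le> d * norm x" .
    \<comment> \<open>The crude bound 2 for \<open>W\<close> on \<open>N\<close> cancels the factor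
      1/2 in the correction term.\<close>
    have "(norm (W (D x)))\<^sup>2 \<le> (norm (D x))\<^sup>2 + d * (norm (D x))\<^sup>2"
      using defect[OF DN[of x]] by linarith
    also have "\<dots> \<le> (norm (D x))\<^sup>2 + 1 * (norm (D x))\<^sup>2"
      using d by (intro add_left_mono mult_right_mono) auto
    also have "\<dots> \<le> (2 * norm (D x))\<^sup>2"
      by (simp add: power_mult_distrib)
    finally have "norm (W (D x)) \<le> 2 * norm (D x)"
      by (rule power2_le_imp_le) auto
    then show "norm (blinfun_apply (W' - W) x) \<le> d * norm x"
      using Dx by (simp add: W'_def blinfun.minus_left blinfun.scaleR_left)
  qed (use d in auto)
  moreover have "\<bar>(norm (W' x))\<^sup>2 - (norm x)\<^sup>2\<bar> \<le> d / 2 * (norm x)\<^sup>2" if x: "x \<in> N" for x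
  proof -
    define e where "e = D x"
    define u where "u = x - (1/2) *\<^sub>R e"
    have e: "e \<in> N" "inner x (D e) = inner e e"
      using inner_D[OF DN[of x] x] inner_D[OF x DN[of x]] DN
        inner_commute[of "W (D x)" "W x"] inner_commute[of "D x" x]
      by (auto simp: e_def)
    have u: "u \<in> N"
      unfolding u_def by (intro closed_csubspaceD(3,5)[OF N] x e)
    have "W' x = W u"
      by (simp add: W'_def u_def e_def blinfun.diff_left blinfun.scaleR_left blinfun.diff_right
          blinfun.scaleR_right)
    then have "(norm (W' x))\<^sup>2 = inner u (D u) + (norm u)\<^sup>2"
      using inner_D[OF u u] by (simp add: power2_norm_eq_inner)
    also have "inner u (D u) = inner x e - inner e e + inner e (D e) / 4"
    proof -
      have "D u = e - (1/2) *\<^sub>R D e"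
        by (simp add: u_def e_def blinfun.diff_right blinfun.scaleR_right)
      then show ?thesis
        by (simp only:) (simp add: u_def inner_diff_left inner_diff_right e(2) diff_divide_distrib)
    qed
    also have "(norm u)\<^sup>2 = (norm x)\<^sup>2 - inner x e + inner e e / 4"
      unfolding u_def norm_diff_squared
      by (simp add: power_divide flip: power2_norm_eq_inner)
    \<comment> \<open>The form of \<open>(1 - D/2) (1 + D) (1 - D/2) - 1 = D^3/4 - 3/4 D^2\<close>:
      the first-order terms cancel.\<close>
    finally have "(norm (W' x))\<^sup>2 - (norm x)\<^sup>2 = inner e (D e) / 4 - 3/4 * (norm e)\<^sup>2"
      by (simp add: power2_norm_eq_inner)
    moreover have "\<bar>inner e (D e)\<bar> \<le> 1 * (norm e)\<^sup>2"
      using form[OF e(1)] d by (elim order_trans) (intro mult_right_mono, auto)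
    ultimately have "\<bar>(norm (W' x))\<^sup>2 - (norm x)\<^sup>2\<bar> \<le> (norm e)\<^sup>2"
      using zero_le_power2[of "norm e"] by linarith
    also have "\<dots> \<le> (d * norm x)\<^sup>2"
      unfolding e_def by (intro power_mono norm_D x) auto
    also have "\<dots> = d * (d * (norm x)\<^sup>2)"
      by (simp add: power2_eq_square)
    \<comment> \<open>Here \<open>d \<le> 1/2\<close> turns the quadratic defect into a halved
      one.\<close>
    also have "\<dots> \<le> 1/2 * (d * (norm x)\<^sup>2)"
      using d by (intro mult_right_mono) auto
    finally show ?thesis
      by simp
  qed
  ultimately show ?thesis
    using W' by blast
qed

text \<open>Iterating the halving step costs \<open>d / 2 ^ n\<close> at stage \<open>n\<close>, in
  total \<open>2 * d\<close>, and the defect vanishes in the limit.\<close>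

lemma isometric_approximation:
  fixes W :: "'a::chilbert_space \<Rightarrow>\<^sub>L 'b::chilbert_space"
  assumes N: "closed_csubspace N" and W: "W \<in> bounded_operators" and d: "0 \<le> d" "d \<le> 1/2"
    and defect: "\<And>x. x \<in> N \<Longrightarrow> \<bar>(norm (W x))\<^sup>2 - (norm x)\<^sup>2\<bar> \<le> d * (norm x)\<^sup>2"
  shows "\<exists>V\<in>bounded_operators. norm (V - W) \<le> 2 * d \<and>
    (\<forall>x\<in>N. norm (blinfun_apply V x) = norm x)"
proof -
  \<comment> \<open>The clause for \<open>n = 0\<close> anchors the chosen sequence at
    \<open>W\<close>.\<close>
  define good where "good n V \<longleftrightarrow> V \<in> bounded_operators \<and> (n = 0 \<longrightarrow> V = W) \<and>
    (\<forall>x\<in>N. \<bar>(norm (blinfun_apply V x))\<^sup>2 - (norm x)\<^sup>2\<bar> \<le> d / 2 ^ n * (norm x)\<^sup>2)"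
    for n and V :: "'a \<Rightarrow>\<^sub>L 'b"
  have "\<exists>V. good 0 V"
    using W defect by (auto simp: good_def)
  moreover have "\<exists>V'. good (Suc n) V' \<and> norm (V' - V) \<le> d / 2 ^ n" if V: "good n V" for n V
  proof -
    have "d / 2 ^ n \<le> d / 1"
      using d by (intro divide_left_mono) auto
    then have "d / 2 ^ n \<le> 1/2"
      using d by linarith
    moreover have "0 \<le> d / 2 ^ n"
      using d by simp
    ultimately obtain V' where "V' \<in> bounded_operators" "norm (V' - V) \<le> d / 2 ^ n"
      "\<forall>x\<in>N. \<bar>(norm (blinfun_apply V' x))\<^sup>2 - (norm x)\<^sup>2\<bar> \<le> d / 2 ^ n / 2 * (norm x)\<^sup>2"
      using isometry_defect_halving[OF N, of V "d / 2 ^ n"] V unfolding good_def by blast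
    then show ?thesis
      by (intro exI[of _ V']) (simp add: good_def mult.commute)
  qed
  ultimately obtain V where V: "\<And>n. good n (V n)" "\<And>n. norm (V (Suc n) - V n) \<le> d / 2 ^ n"
    using dependent_nat_choice[of good "\<lambda>n V V'. norm (V' - V) \<le> d / 2 ^ n"] by metis
  define L where "L = W + (\<Sum>n. V (Suc n) - V n)"
  have g: "(\<lambda>n. d / 2 ^ n) sums (2 * d)"
    using sums_mult[OF geometric_sums[of "1/2::real"], of d]
    by (simp add: power_one_over mult.commute[of d 2])
  \<comment> \<open>Absolute convergence suffices because operators into a complete space form a
    complete space.\<close>
  have sm: "summable (\<lambda>n. V (Suc n) - V n)"
    using V(2) sums_summable[OF g] by - (rule summable_comparison_test[of _ "\<lambda>n. d / 2 ^ n"], auto)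
  have "V 0 = W"
    using V(1)[of 0] by (simp add: good_def)
  then have "V n = W + (\<Sum>i<n. V (Suc i) - V i)" for n
    by (simp add: sum_lessThan_telescope)
  then have "V = (\<lambda>n. W + (\<Sum>i<n. V (Suc i) - V i))"
    by blast
  then have lim: "V \<longlonglongrightarrow> L"
    using tendsto_add[OF tendsto_const[of W] summable_LIMSEQ[OF sm]] by (simp only: L_def)
  have "L \<in> bounded_operators"
    using closed_bounded_operators lim V(1) closed_sequentially unfolding good_def by blast
  moreover have "norm (L - W) \<le> 2 * d"
    using norm_suminf_le[OF V(2) sums_summable[OF g]] sums_unique[OF g] by (simp add: L_def)
  moreover have "norm (L x) = norm x" if "x \<in> N" for x
  proof -
    have "(\<lambda>n. \<bar>(norm (V n x))\<^sup>2 - (norm x)\<^sup>2\<bar>) \<longlonglongrightarrow> \<bar>(norm (L x))\<^sup>2 - (norm x)\<^sup>2\<bar>"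
      by (intro tendsto_intros blinfun.tendsto lim)
    moreover have "(\<lambda>n. d / 2 ^ n * (norm x)\<^sup>2) \<longlonglongrightarrow> 0 * (norm x)\<^sup>2"
      using sums_summable[OF g] by (intro tendsto_mult summable_LIMSEQ_zero tendsto_const)
    ultimately have "\<bar>(norm (L x))\<^sup>2 - (norm x)\<^sup>2\<bar> \<le> 0 * (norm x)\<^sup>2"
      using V(1) that by (intro LIMSEQ_le) (auto simp: good_def)
    then show ?thesis
      by (simp add: power2_eq_iff_nonneg)
  qed
  ultimately show ?thesis
    by blast
qed

lemma essentially_isometric_subset_closure:
  "(essentially_isometric :: ('a::chilbert_space \<Rightarrow>\<^sub>L 'b::chilbert_space) set)
    \<subseteq> closure finite_codim_isometric"
proof
  fix T :: "'a \<Rightarrow>\<^sub>L 'b"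
  assume "T \<in> essentially_isometric"
  then obtain \<alpha> where T: "T \<in> bounded_operators" and "\<alpha> \<ge> 0"
    and F: "\<And>\<epsilon>. \<epsilon> > 0 \<Longrightarrow> \<exists>F. finite F \<and>
      (\<forall>x\<in>orth F. \<bar>norm (blinfun_apply T x) - \<alpha> * norm x\<bar> \<le> \<epsilon> * norm x)"
    by (auto simp: essentially_isometric_def)
  have "\<exists>S\<in>finite_codim_isometric. dist S T < \<epsilon>" if "\<epsilon> > 0" for \<epsilon>
  proof (cases "\<alpha> = 0")
    case True
    obtain F where F: "finite F" "\<And>x. x \<in> orth F \<Longrightarrow> norm (T x) \<le> \<epsilon> / 2 * norm x"
      using F[of "\<epsilon> / 2"] True \<open>\<epsilon> > 0\<close> by auto
    obtain P where P: "P \<in> bounded_operators" "\<And>x. blinfun_apply P x \<in> orth F"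
      "\<And>x. x \<in> orth F \<Longrightarrow> P x = x" "\<And>x. norm (P x) \<le> norm x"
      using projection_operator_exists[OF closed_csubspace_orth[of F]] by metis
    \<comment> \<open>\<open>T\<close> is small on \<open>orth F\<close>; cutting it off there
      leaves an operator that vanishes on \<open>orth F\<close>.\<close>
    define S where "S = T - (T o\<^sub>L P)"
    have "norm (T o\<^sub>L P) \<le> \<epsilon> / 2"
    proof (rule norm_blinfun_bound)
      fix x
      have "norm (T (P x)) \<le> \<epsilon> / 2 * norm (P x)"
        using F P by blast
      also have "\<dots> \<le> \<epsilon> / 2 * norm x"
        using P \<open>\<epsilon> > 0\<close> by (intro mult_left_mono) auto
      finally show "norm (blinfun_apply (T o\<^sub>L P) x) \<le> \<epsilon> / 2 * norm x"
        by simp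
    qed (use \<open>\<epsilon> > 0\<close> in auto)
    moreover have "S \<in> bounded_operators"
      unfolding S_def using T P by (intro bounded_operators_diff bounded_operators_compose)
    moreover have "norm (S x) = 0 * norm x" if "x \<in> orth F" for x
      using P that by (simp add: S_def blinfun.diff_left)
    ultimately have "S \<in> finite_codim_isometric" "dist S T < \<epsilon>"
      using F \<open>\<epsilon> > 0\<close> unfolding finite_codim_isometric_def by (blast, simp add: S_def dist_norm)
    then show ?thesis
      by blast
  next
    case False
    then have "\<alpha> > 0"
      using \<open>\<alpha> \<ge> 0\<close> by simp
    \<comment> \<open>The bound \<open>\<alpha> / 6\<close> keeps the defect \<open>3 * q\<close> of
      \<open>W\<close> at most 1/2. The bound \<open>\<epsilon> / 7\<close> makes the final error
      \<open>6 * \<eta>\<close> less than \<open>\<epsilon>\<close>.\<close>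
    define \<eta> where "\<eta> = min (\<epsilon> / 7) (\<alpha> / 6)"
    have \<eta>: "\<eta> > 0" "\<eta> \<le> \<epsilon> / 7" "\<eta> \<le> \<alpha> / 6"
      using \<open>\<epsilon> > 0\<close> \<open>\<alpha> > 0\<close> by (auto simp: \<eta>_def)
    obtain F where F: "finite F" "\<And>x. x \<in> orth F \<Longrightarrow> \<bar>norm (T x) - \<alpha> * norm x\<bar> \<le> \<eta> * norm x"
      using F[OF \<eta>(1)] by auto
    define W where "W = (1 / \<alpha>) *\<^sub>R T"
    define q where "q = \<eta> / \<alpha>"
    have q: "0 < q" "q \<le> 1/6"
      using \<eta> \<open>\<alpha> > 0\<close> by (auto simp: q_def field_simps)
    have W: "W \<in> bounded_operators"
      unfolding W_def using T by (rule bounded_operators_scaleR)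
    have "\<bar>(norm (W x))\<^sup>2 - (norm x)\<^sup>2\<bar> \<le> 3 * q * (norm x)\<^sup>2" if x: "x \<in> orth F" for x
    proof -
      have "norm (W x) - norm x = (norm (T x) - \<alpha> * norm x) / \<alpha>"
        using \<open>\<alpha> > 0\<close> by (simp add: W_def blinfun.scaleR_left field_simps)
      then have 1: "\<bar>norm (W x) - norm x\<bar> \<le> q * norm x"
        using F(2)[OF x] \<open>\<alpha> > 0\<close> by (simp add: q_def divide_right_mono)
      moreover have "q * norm x \<le> 1 * norm x"
        using q by (intro mult_right_mono) auto
      ultimately have 2: "norm (W x) + norm x \<le> 3 * norm x"
        by linarith
      have "\<bar>(norm (W x))\<^sup>2 - (norm x)\<^sup>2\<bar> = \<bar>norm (W x) - norm x\<bar> * (norm (W x) + norm x)"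
        by (simp add: power2_eq_square square_diff_square_factored abs_mult)
      also have "\<dots> \<le> (q * norm x) * (3 * norm x)"
        using 1 2 q by (intro mult_mono) auto
      finally show ?thesis
        by (simp add: power2_eq_square mult_ac)
    qed
    then obtain V where V: "V \<in> bounded_operators" "norm (V - W) \<le> 2 * (3 * q)"
      "\<And>x. x \<in> orth F \<Longrightarrow> norm (blinfun_apply V x) = norm x"
      using isometric_approximation[OF closed_csubspace_orth W, of "3 * q" F] q by auto
    define S where "S = \<alpha> *\<^sub>R V"
    have "S \<in> bounded_operators"
      unfolding S_def using V by (intro bounded_operators_scaleR)
    moreover have "norm (S x) = \<alpha> * norm x" if "x \<in> orth F" for x
      using V that \<open>\<alpha> > 0\<close> by (simp add: S_def blinfun.scaleR_left)
    ultimately have "S \<in> finite_codim_isometric"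
      using F unfolding finite_codim_isometric_def by blast
    moreover have "S - T = \<alpha> *\<^sub>R (V - W)"
      using \<open>\<alpha> > 0\<close> by (simp add: S_def W_def scaleR_diff_right)
    then have "dist S T \<le> \<alpha> * (2 * (3 * q))"
      using V(2) \<open>\<alpha> > 0\<close> by (simp add: dist_norm)
    then have "dist S T < \<epsilon>"
      using \<eta> \<open>\<alpha> > 0\<close> \<open>\<epsilon> > 0\<close> by (simp add: q_def)
    ultimately show ?thesis
      by blast
  qed
  then show "T \<in> closure finite_codim_isometric"
    by (simp add: closure_approachable)
qed

section \<open>Operators that are not essentially isometric\<close>

text \<open>Let \<open>a\<close> be the infimum of the upper bounds of \<open>norm (T x)\<close> on
  unit spheres of finite codimension. Since \<open>T\<close> is not essentially isometric with
  factor \<open>a\<close>, every such sphere has values at distance more than some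
  \<open>\<epsilon>\<close> from \<open>a\<close>. They can be forced below
  \<open>a - \<epsilon>\<close>, while values near \<open>a\<close> persist; the intermediate value
  theorem fills the gap.\<close>

lemma attained_interval_if_not_essentially_isometric:
  fixes T :: "'a::chilbert_space \<Rightarrow>\<^sub>L 'b::chilbert_space"
  assumes T: "T \<in> bounded_operators" "T \<notin> essentially_isometric"
  obtains s t where "0 \<le> s" "s < t"
    "\<And>F c. finite F \<Longrightarrow> s < c \<Longrightarrow> c < t \<Longrightarrow> \<exists>x\<in>orth F. norm x = 1 \<and> norm (T x) = c"
proof -
  have norm1: "norm ((1 / norm x) *\<^sub>R x) = 1" "norm (T ((1 / norm x) *\<^sub>R x)) = norm (T x) / norm x"
    "(1 / norm x) *\<^sub>R x \<in> orth F \<longleftrightarrow> x \<in> orth F" if "x \<noteq> 0" for x F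
    using that by (auto simp: blinfun.scaleR_right orth_def cinner_scaleR_left)
  have ex: "\<exists>\<epsilon>>0. \<forall>F. finite F \<longrightarrow> (\<exists>x\<in>orth F. norm x = 1 \<and> \<bar>norm (T x) - \<alpha>\<bar> > \<epsilon>)"
    if \<alpha>: "\<alpha> \<ge> 0" for \<alpha>
  proof -
    have "\<not> (\<forall>\<epsilon>>0. \<exists>F. finite F \<and>
        (\<forall>x\<in>orth F. \<bar>norm (T x) - \<alpha> * norm x\<bar> \<le> \<epsilon> * norm x))"
      using T \<alpha> unfolding essentially_isometric_def by blast
    then obtain \<epsilon> where "\<epsilon> > 0"
      and *: "\<And>F. finite F \<Longrightarrow> \<exists>x\<in>orth F. \<epsilon> * norm x < \<bar>norm (T x) - \<alpha> * norm x\<bar>"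
      by (auto simp: not_le)
    moreover have "\<exists>x\<in>orth F. norm x = 1 \<and> \<bar>norm (T x) - \<alpha>\<bar> > \<epsilon>" if F: "finite F" for F
    proof -
      obtain x where x: "x \<in> orth F" "\<epsilon> * norm x < \<bar>norm (T x) - \<alpha> * norm x\<bar>"
        using *[OF F] by blast
      then have nz: "x \<noteq> 0"
        by auto
      have "\<bar>norm (T x) / norm x - \<alpha>\<bar> = \<bar>norm (T x) - \<alpha> * norm x\<bar> / norm x"
      proof -
        have "norm (T x) / norm x - \<alpha> = (norm (T x) - \<alpha> * norm x) / norm x"
          using nz by (simp add: diff_divide_distrib)
        then show ?thesis
          by simp
      qed
      also have "\<dots> > \<epsilon>"
        using x nz by (simp add: less_divide_eq)
      finally show ?thesis
        using norm1[OF nz] x(1) by (intro bexI[of _ "(1 / norm x) *\<^sub>R x"]) auto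
    qed
    ultimately show ?thesis
      by blast
  qed
  define B where "B = {t. \<exists>F. finite F \<and> (\<forall>x\<in>orth F. norm x = 1 \<longrightarrow> norm (T x) \<le> t)}"
  define a where "a = Inf B"
  have B_nonneg: "0 \<le> t" if t: "t \<in> B" for t
  proof -
    obtain F where F: "finite F" "\<forall>x\<in>orth F. norm x = 1 \<longrightarrow> norm (T x) \<le> t"
      using t by (auto simp: B_def)
    \<comment> \<open>The case \<open>\<alpha> = 0\<close> of \<open>ex\<close> also shows that
      every \<open>orth F\<close> contains a unit vector.\<close>
    then obtain x where "x \<in> orth F" "norm x = 1"
      using ex[of 0] by auto
    then show ?thesis
      using F norm_ge_zero order_trans by blast
  qed
  have "norm (T x) \<le> norm T" if "norm x = 1" for x
    using norm_blinfun[of T x] that by simp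
  then have "norm T \<in> B"
    by (auto simp: B_def intro!: exI[of _ "{}"])
  then have B: "B \<noteq> {}" "bdd_below B"
    using B_nonneg by (auto intro: bdd_belowI[of _ 0])
  have "a \<ge> 0"
    unfolding a_def using B B_nonneg by (intro cInf_greatest)
  then obtain \<epsilon> where \<epsilon>: "\<epsilon> > 0"
    and gap: "\<And>F. finite F \<Longrightarrow> \<exists>x\<in>orth F. norm x = 1 \<and> \<bar>norm (T x) - a\<bar> > \<epsilon>"
    using ex by blast
  obtain t0 where "t0 \<in> B" "t0 < a + \<epsilon>"
    using cInf_lessD[of B "a + \<epsilon>"] B \<epsilon> by (auto simp: a_def)
  \<comment> \<open>On \<open>orth F0\<close> the values above \<open>a + \<epsilon>\<close> are
    excluded, so those given by \<open>gap\<close> must lie below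
    \<open>a - \<epsilon>\<close>.\<close>
  then obtain F0 where F0: "finite F0" "\<forall>x\<in>orth F0. norm x = 1 \<longrightarrow> norm (T x) < a + \<epsilon>"
    by (fastforce simp: B_def)
  have low: "\<exists>x\<in>orth F. norm x = 1 \<and> norm (T x) < a - \<epsilon>" if "finite F" for F
  proof -
    obtain x where x: "x \<in> orth (F \<union> F0)" "norm x = 1" "\<bar>norm (T x) - a\<bar> > \<epsilon>"
      using gap[of "F \<union> F0"] \<open>finite F\<close> F0 by auto
    then have "x \<in> orth F" "x \<in> orth F0"
      by (auto simp: orth_def)
    then show ?thesis
      using F0 x by force
  qed
  have high: "\<exists>x\<in>orth F. norm x = 1 \<and> norm (T x) > a - \<epsilon> / 2" if F: "finite F" for F
  proof (rule ccontr)
    assume "\<not> ?thesis"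
    then have "a - \<epsilon> / 2 \<in> B"
      using F by (auto simp: B_def not_less)
    then have "a \<le> a - \<epsilon> / 2"
      unfolding a_def using B by (intro cInf_lower)
    then show False
      using \<epsilon> by simp
  qed
  show thesis
  proof (rule that[of "a - \<epsilon>" "a - \<epsilon> / 2"])
    obtain x where "norm (T x) < a - \<epsilon>"
      using low[of "{}"] by auto
    then show "0 \<le> a - \<epsilon>"
      using norm_ge_zero[of "T x"] by linarith
    show "a - \<epsilon> < a - \<epsilon> / 2"
      using \<epsilon> by simp
    fix F :: "'a set" and c
    assume F: "finite F" and c: "a - \<epsilon> < c" "c < a - \<epsilon> / 2"
    obtain x where x: "x \<in> orth F" "norm x = 1" "norm (T x) < a - \<epsilon>"
      using low[OF F] by blast
    obtain y where y: "y \<in> orth F" "norm y = 1" "norm (T y) > a - \<epsilon> / 2"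
      using high[OF F] by blast
    define z where "z \<tau> = (1 - \<tau>) *\<^sub>R x + \<tau> *\<^sub>R y" for \<tau> :: real
    \<comment> \<open>A zero of \<open>h\<close> off the origin yields the value \<open>c\<close>
      after normalisation, so the path need not stay on the sphere.\<close>
    define h where "h \<tau> = norm (T (z \<tau>)) - c * norm (z \<tau>)" for \<tau>
    have "continuous_on {0..1} h"
      unfolding h_def z_def by (intro continuous_intros)
    moreover have "h 0 \<le> 0" "0 \<le> h 1"
      using x y c by (auto simp: h_def z_def)
    ultimately obtain \<tau> where \<tau>: "0 \<le> \<tau>" "\<tau> \<le> 1" "h \<tau> = 0"
      using IVT'[of h 0 0 1] by auto
    \<comment> \<open>The segment meets 0 only if \<open>y = - x\<close>, but then \<open>x\<close>
      and \<open>y\<close> would have images of equal norm.\<close>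
    have nz: "z \<tau> \<noteq> 0"
    proof
      assume "z \<tau> = 0"
      then have eq: "\<tau> *\<^sub>R y = - ((1 - \<tau>) *\<^sub>R x)"
        by (simp add: z_def add_eq_0_iff)
      then have "norm (\<tau> *\<^sub>R y) = norm ((1 - \<tau>) *\<^sub>R x)"
        by simp
      then have half: "\<tau> = 1/2"
        using \<tau> x y by simp
      have "(1/2) *\<^sub>R y = (1/2) *\<^sub>R (- x)"
        using eq by (simp add: half)
      then have "y = - x"
        by (simp only: scaleR_cancel_left) simp
      then show False
        using x y c by (simp add: blinfun.minus_right)
    qed
    have "z \<tau> \<in> orth F"
      using x y by (auto simp: z_def orth_def cinner_add_left cinner_scaleR_left)
    moreover have "norm (T (z \<tau>)) / norm (z \<tau>) = c"
      using \<tau> nz by (simp add: h_def)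
    ultimately show "\<exists>x\<in>orth F. norm x = 1 \<and> norm (T x) = c"
      using norm1[OF nz] by metis
  qed
qed

section \<open>Closed spans and subspaces on which an extremum is not attained\<close>

lemma closed_csubspace_closure:
  fixes S :: "'a::complex_inner set"
  assumes "complex_vector.subspace S"
  shows "closed_csubspace (closure S)"
proof -
  have "x + y \<in> closure S" if xy: "x \<in> closure S" "y \<in> closure S" for x y
  proof -
    obtain f g where "\<And>n. f n \<in> S" "f \<longlonglongrightarrow> x" "\<And>n. g n \<in> S" "g \<longlonglongrightarrow> y"
      using xy unfolding closure_sequential by blast
    then show ?thesis
      unfolding closure_sequential using complex_vector.subspace_add[OF assms]
      by (intro exI[of _ "\<lambda>n. f n + g n"]) (auto intro: tendsto_add)
  qed
  moreover have "scaleC a x \<in> closure S" if x: "x \<in> closure S" for a x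
  proof -
    obtain f where "\<And>n. f n \<in> S" "f \<longlonglongrightarrow> x"
      using x unfolding closure_sequential by blast
    then show ?thesis
      unfolding closure_sequential using complex_vector.subspace_scale[OF assms]
      by (intro exI[of _ "\<lambda>n. scaleC a (f n)"])
        (auto intro: bounded_linear.tendsto[OF bounded_linear_scaleC])
  qed
  moreover have "0 \<in> closure S"
    using complex_vector.subspace_0[OF assms] closure_subset by blast
  ultimately show ?thesis
    by (simp add: closed_csubspace_def complex_vector.subspace_def)
qed

lemma closure_span_minimal:
  assumes "S \<subseteq> N" "closed_csubspace N"
  shows "closure (complex_vector.span S) \<subseteq> N"
  using assms unfolding closed_csubspace_def
  by (intro closure_minimal complex_vector.span_minimal) auto

lemma span_range_finite:
  fixes e :: "nat \<Rightarrow> 'a::complex_vector"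
  assumes "x \<in> complex_vector.span (range e)"
  shows "\<exists>n. x \<in> complex_vector.span (e ` {..<n})"
proof -
  have mono: "complex_vector.span (e ` {..<n}) \<subseteq> complex_vector.span (e ` {..<m})"
    if "n \<le> m" for n m :: nat
    using that by (intro complex_vector.span_mono image_mono) auto
  have "complex_vector.subspace {x. \<exists>n. x \<in> complex_vector.span (e ` {..<n})}"
    unfolding complex_vector.subspace_def
  proof (intro conjI ballI allI; clarsimp)
    show "\<exists>n. 0 \<in> complex_vector.span (e ` {..<n})"
      using complex_vector.span_zero by blast
    show "\<exists>n. x + y \<in> complex_vector.span (e ` {..<n})"
      if "x \<in> complex_vector.span (e ` {..<m})" "y \<in> complex_vector.span (e ` {..<k})" for x y m k
    proof -
      have "x \<in> complex_vector.span (e ` {..<max m k})" "y \<in> complex_vector.span (e ` {..<max m k})"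
        using that mono[of m "max m k"] mono[of k "max m k"] by auto
      then show ?thesis
        using complex_vector.span_add by blast
    qed
    show "\<exists>n. scaleC c x \<in> complex_vector.span (e ` {..<n})"
      if "x \<in> complex_vector.span (e ` {..<m})" for c x m
      using that complex_vector.span_scale by blast
  qed
  moreover have "\<exists>n. e i \<in> complex_vector.span (e ` {..<n})" for i
    by (rule exI[of _ "Suc i"]) (auto intro: complex_vector.span_base)
  ultimately show ?thesis
    using assms complex_vector.span_induct[of x "range e" "\<lambda>x. \<exists>n. x \<in> complex_vector.span (e ` {..<n})"]
    by blast
qed

text \<open>
  The sign \<open>\<sigma> = 1\<close> excludes a maximum and \<open>\<sigma> = -1\<close> a minimum. The subspace is spanned by
  eigenvectors of the compression of \<open>T\<^sup>* T\<close>, whose eigenvalues converge strictly monotonically.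
\<close>

lemma unattained_subspace_exists:
  fixes T :: "'a::chilbert_space \<Rightarrow>\<^sub>L 'b::chilbert_space" and \<sigma> :: real
  assumes T: "T \<in> bounded_operators" "T \<notin> essentially_isometric" and \<sigma>: "\<sigma> = 1 \<or> \<sigma> = -1"
  obtains M c e where "closed_csubspace M" "\<And>n. e n \<in> M" "\<And>n. norm (e n) = 1"
    "(\<lambda>n::nat. norm (T (e n))) \<longlonglongrightarrow> c" "\<And>x. x \<in> M \<Longrightarrow> norm x = 1 \<Longrightarrow> \<sigma> * norm (T x) < \<sigma> * c"
proof -
  obtain s t where st: "0 \<le> s" "s < t"
    and attained: "\<And>F c. finite F \<Longrightarrow> s < c \<Longrightarrow> c < t \<Longrightarrow> \<exists>x\<in>orth F. norm x = 1 \<and> norm (T x) = c"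
    using attained_interval_if_not_essentially_isometric[OF T] by blast
  obtain A where A: "A \<in> bounded_operators" "\<And>x y. cinner (T x) y = cinner x (blinfun_apply A y)"
    using adjoint_exists[OF T(1)] by blast
  define c where "c = (s + t) / 2"
  \<comment> \<open>The values approach \<open>c\<close> from below for \<open>\<sigma> = 1\<close>
    and from above for \<open>\<sigma> = -1\<close>. The double successor keeps already
    \<open>b 0\<close> strictly inside the interval.\<close>
  define b where "b n = c - \<sigma> * ((t - s) / 2 * (1 / real (Suc (Suc n))))" for n
  have bounds: "0 < (t - s) / 2 * (1 / real (Suc (Suc n)))"
    "(t - s) / 2 * (1 / real (Suc (Suc n))) < (t - s) / 2" for n
    using st mult_strict_left_mono[of "1 / real (Suc (Suc n))" 1 "(t - s) / 2"]
    by (auto simp del: of_nat_Suc)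
  have b: "s < b n" "b n < t" "\<sigma> * b n < \<sigma> * c" for n
    using bounds[of n] \<sigma> by (auto simp: b_def c_def field_simps simp del: of_nat_Suc)
  have "(\<lambda>n. 1 / real (Suc (Suc n))) \<longlonglongrightarrow> 0"
    using LIMSEQ_Suc[OF LIMSEQ_inverse_real_of_nat] by (simp add: inverse_eq_divide)
  then have "b \<longlonglongrightarrow> c - \<sigma> * ((t - s) / 2 * 0)"
    unfolding b_def by (intro tendsto_intros)
  then have b_lim: "b \<longlonglongrightarrow> c"
    by simp
  \<comment> \<open>The second component is the chosen vector; the first collects the constraints to
    which it is orthogonal after stage 0.\<close>
  define good where "good n p \<longleftrightarrow> finite (fst p) \<and> norm (snd p) = 1 \<and> norm (T (snd p)) = b n"
    for n and p :: "'a set \<times> 'a"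
  \<comment> \<open>Orthogonality to \<open>A (T e)\<close> is orthogonality of the images under
    \<open>T\<close>.\<close>
  define succ where "succ p q \<longleftrightarrow> insert (snd p) (insert (A (T (snd p))) (fst p)) \<subseteq> fst q \<and>
    snd q \<in> orth (fst q)" for p q :: "'a set \<times> 'a"
  have "\<exists>p. good 0 p"
    using attained[of "{}", OF _ b(1,2)] by (auto simp: good_def intro!: exI[of _ "{}"])
  moreover have "\<exists>q. good (Suc n) q \<and> succ p q" if p: "good n p" for n p
  proof -
    define F where "F = insert (snd p) (insert (A (T (snd p))) (fst p))"
    have "finite F"
      using p by (simp add: F_def good_def)
    then obtain x where "x \<in> orth F" "norm x = 1" "norm (T x) = b (Suc n)"
      using attained[OF _ b(1,2)] by blast
    then show ?thesis
      using \<open>finite F\<close> by (intro exI[of _ "(F, x)"]) (simp add: good_def succ_def F_def)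
  qed
  ultimately obtain f where "\<And>n. good n (f n)" "\<And>n. succ (f n) (f (Suc n))"
    using dependent_nat_choice[of good "\<lambda>_. succ"] by metis
  then have f: "\<And>n. norm (snd (f n)) = 1" "\<And>n. norm (T (snd (f n))) = b n"
    "\<And>n. insert (snd (f n)) (insert (A (T (snd (f n)))) (fst (f n))) \<subseteq> fst (f (Suc n))"
    "\<And>n. snd (f (Suc n)) \<in> orth (fst (f (Suc n)))"
    unfolding good_def succ_def by blast+
  define e where "e n = snd (f n)" for n
  have e: "norm (e n) = 1" "norm (T (e n)) = b n" for n
    using f by (auto simp: e_def)
  have mono: "fst (f i) \<subseteq> fst (f j)" if "i \<le> j" for i j
    using f(3) by (intro lift_Suc_mono_le[OF _ that]) auto
  have less: "cinner (e j) (e i) = 0 \<and> cinner (T (e j)) (T (e i)) = 0" if "i < j" for i j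
  proof -
    obtain k where k: "j = Suc k" "i \<le> k"
      using \<open>i < j\<close> by (cases j) auto
    have "{e i, A (T (e i))} \<subseteq> fst (f (Suc i))"
      using f(3)[of i] by (auto simp: e_def)
    also have "\<dots> \<subseteq> fst (f j)"
      using that by (intro mono) auto
    finally show ?thesis
      using f(4)[of k] k by (auto simp: orth_def e_def A(2))
  qed
  have e_orth: "cinner (e j) (e i) = 0 \<and> cinner (T (e j)) (T (e i)) = 0" if "i \<noteq> j" for i j
    using less[of i j] less[of j i] that cinner_eq_zero_sym[of "e i" "e j"]
      cinner_eq_zero_sym[of "T (e i)" "T (e j)"] by (auto simp: nat_neq_iff)
  define M where "M = closure (complex_vector.span (range e))"
  have M: "closed_csubspace M"
    unfolding M_def by (intro closed_csubspace_closure complex_vector.subspace_span)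
  have eM: "e n \<in> M" for n
    unfolding M_def by (meson closure_subset complex_vector.span_base rangeI subsetD)
  \<comment> \<open>The residual \<open>?v\<close> is orthogonal to every \<open>e i\<close>, hence
    to \<open>M\<close>. Thus \<open>e n\<close> is an eigenvector of the compression of
    \<open>T\<^sup>* T\<close> to \<open>M\<close>.\<close>
  have eigen: "cinner (T y) (T (e n)) = of_real ((b n)\<^sup>2) * cinner y (e n)" if "y \<in> M" for y n
  proof -
    let ?v = "A (T (e n)) - (b n)\<^sup>2 *\<^sub>R e n"
    have "cinner (e i) ?v = 0" for i
    proof (cases "i = n")
      case True
      then show ?thesis
        using e by (simp add: cinner_diff_right cinner_scaleR_right cinner_self flip: A(2))
    next
      case False
      then show ?thesis
        using e_orth[of n i] by (simp add: cinner_diff_right cinner_scaleR_right flip: A(2))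
    qed
    then have "M \<subseteq> orth {?v}"
      unfolding M_def by (intro closure_span_minimal closed_csubspace_orth) (auto simp: orth_def)
    then have "cinner y ?v = 0"
      using that by (auto simp: orth_def)
    then show ?thesis
      by (simp add: cinner_diff_right cinner_scaleR_right flip: A(2))
  qed
  \<comment> \<open>It remains to show that this form is positive definite on \<open>M\<close>;
    \<open>\<kappa> n\<close> is its eigenvalue at \<open>e n\<close>.\<close>
  define r where "r x = \<sigma> * (c\<^sup>2 * (norm x)\<^sup>2 - (norm (T x))\<^sup>2)" for x
  define \<kappa> where "\<kappa> n = \<sigma> * (c\<^sup>2 - (b n)\<^sup>2)" for n
  have "c > 0"
    using st by (simp add: c_def)
  have b_pos: "b n > 0" for n
    using b(1)[of n] st by linarith
  have \<kappa>: "\<kappa> n > 0" for n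
    using \<sigma> b(3)[of n] b_pos[of n] \<open>c > 0\<close>
    by (auto simp: \<kappa>_def intro!: power_strict_mono)
  \<comment> \<open>By \<open>eigen\<close>, orthogonality to \<open>e n\<close> within
    \<open>M\<close> passes to the images, so there is no cross term.\<close>
  have split: "r (scaleC k (e n) + y) = (cmod k)\<^sup>2 * \<kappa> n + r y"
    if "y \<in> M" "cinner y (e n) = 0" for k n y
  proof -
    have "cinner (T y) (T (e n)) = 0"
      using eigen that by simp
    then have "cinner y (scaleC k (e n)) = 0" "cinner (T y) (T (scaleC k (e n))) = 0"
      using that by (auto simp: bounded_operators_scaleC[OF T(1)] cinner_scaleC_right)
    then have "inner (scaleC k (e n)) y = 0" "inner (T (scaleC k (e n))) (T y) = 0"
      by (metis cinner_eq_zeroD inner_commute)+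
    then have "(norm (scaleC k (e n) + y))\<^sup>2 = (cmod k)\<^sup>2 + (norm y)\<^sup>2"
      "(norm (T (scaleC k (e n) + y)))\<^sup>2 = (cmod k)\<^sup>2 * (b n)\<^sup>2 + (norm (T y))\<^sup>2"
      by (simp_all add: blinfun.add_right norm_add_orth bounded_operators_scaleC[OF T(1)]
          norm_scaleC e power_mult_distrib)
    then show ?thesis
      by (simp add: r_def \<kappa>_def algebra_simps)
  qed
  have span_M: "complex_vector.span (e ` {..<n}) \<subseteq> M" for n
    unfolding M_def
    by (rule order_trans[OF complex_vector.span_mono closure_subset]) auto
  have r_span: "r x \<ge> 0" if "x \<in> complex_vector.span (e ` {..<n})" for x n
    using that
  proof (induction n arbitrary: x)
    case 0
    then show ?case
      by (simp add: r_def)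
  next
    case (Suc n)
    then obtain k where k: "x - scaleC k (e n) \<in> complex_vector.span (e ` {..<n})"
      by (auto simp: lessThan_Suc complex_vector.span_insert)
    define y where "y = x - scaleC k (e n)"
    have "e n \<in> orth (e ` {..<n})"
      using less by (auto simp: orth_def)
    then have "cinner (e n) y = 0"
      using k by (auto intro: orth_span simp: y_def)
    then have "cinner y (e n) = 0"
      by (subst cinner_eq_zero_sym)
    moreover have "y \<in> M"
      using k span_M by (auto simp: y_def)
    ultimately have "r (scaleC k (e n) + y) = (cmod k)\<^sup>2 * \<kappa> n + r y"
      by (intro split)
    then have "r x = (cmod k)\<^sup>2 * \<kappa> n + r y"
      by (simp add: y_def)
    then show ?case
      using Suc.IH[of y] k \<kappa>[of n] by (simp add: y_def)
  qed
  have "closed {x. 0 \<le> r x}"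
    unfolding r_def by (intro closed_Collect_le continuous_intros)
  then have r_M: "r x \<ge> 0" if "x \<in> M" for x
    using closure_minimal[of "complex_vector.span (range e)" "{x. 0 \<le> r x}"] that r_span
      span_range_finite unfolding M_def by blast
  \<comment> \<open>Splitting off any \<open>e n\<close> leaves a nonnegative remainder. If
    \<open>r x\<close> were not positive, every coefficient of \<open>x\<close> would vanish, making
    \<open>x\<close> orthogonal to \<open>M\<close> and hence zero.\<close>
  have r_pos: "r x > 0" if x: "x \<in> M" "x \<noteq> 0" for x
  proof (rule ccontr)
    assume "\<not> r x > 0"
    have "cinner x (e n) = 0" for n
    proof -
      define k where "k = cinner x (e n)"
      define y where "y = x - scaleC k (e n)"
      have y: "y \<in> M" "cinner y (e n) = 0"
        using x eM closed_csubspaceD[OF M] e(1)[of n]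
        by (auto simp: y_def k_def cinner_diff_left cinner_scaleC_left cinner_self)
      have "r x = (cmod k)\<^sup>2 * \<kappa> n + r y"
        using split[OF y, of k] by (simp add: y_def)
      then have "(cmod k)\<^sup>2 * \<kappa> n \<le> 0"
        using r_M[OF y(1)] \<open>\<not> r x > 0\<close> by linarith
      then show ?thesis
        using \<kappa>[of n] by (auto simp: mult_le_0_iff k_def)
    qed
    then have "M \<subseteq> orth {x}"
      unfolding M_def using cinner_eq_zero_sym[of x]
      by (intro closure_span_minimal closed_csubspace_orth) (auto simp: orth_def)
    then have "cinner x x = 0"
      using x by (auto simp: orth_def)
    then show False
      using x by simp
  qed
  show thesis
  proof (rule that[OF M eM e(1)])
    show "(\<lambda>n. norm (T (e n))) \<longlonglongrightarrow> c"
      using b_lim by (simp add: e)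
    fix x
    assume x: "x \<in> M" "norm x = 1"
    then have "x \<noteq> 0"
      by auto
    then have "\<sigma> * (c\<^sup>2 - (norm (T x))\<^sup>2) > 0"
      using r_pos[OF x(1)] x(2) by (simp add: r_def)
    then show "\<sigma> * norm (T x) < \<sigma> * c"
      using \<sigma> \<open>c > 0\<close> power2_less_imp_less[of "norm (T x)" c]
        power2_less_imp_less[of c "norm (T x)"] by auto
  qed
qed

section \<open>Both classes consist of essentially isometric operators; equality of the
  closures\<close>

lemma AN_subset_essentially_isometric:
  "(AN :: ('a::chilbert_space \<Rightarrow>\<^sub>L 'b::chilbert_space) set) \<subseteq> essentially_isometric"
proof (rule subsetI, rule ccontr)
  fix T :: "'a \<Rightarrow>\<^sub>L 'b"
  assume T: "T \<in> AN" "T \<notin> essentially_isometric"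
  then have "T \<in> bounded_operators"
    by (simp add: AN_def)
  from this T(2) obtain M c e where M: "closed_csubspace M" "\<And>n::nat. e n \<in> M" "\<And>n. norm (e n) = 1"
    "(\<lambda>n. norm (T (e n))) \<longlonglongrightarrow> c" "\<And>x. x \<in> M \<Longrightarrow> norm x = 1 \<Longrightarrow> 1 * norm (T x) < 1 * c"
    by (rule unattained_subspace_exists[where \<sigma> = 1]) auto
  have "M \<noteq> {0}"
    using M(2,3) by (metis norm_zero singletonD zero_neq_one)
  then obtain x where x: "x \<in> M" "norm x = 1" "norm (T x) = onorm_on M T"
    using T M(1) unfolding AN_def norm_attaining_on_def by blast
  \<comment> \<open>Boundedness makes the supremum in \<open>onorm_on\<close> a genuine upper bound
    for the values at \<open>e n\<close>.\<close>
  have "norm (T y) / norm y \<le> norm T" for y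
    using norm_blinfun[of T y] by (cases "y = 0") (auto simp: divide_le_eq)
  then have "bdd_above ((\<lambda>x. norm (T x) / norm x) ` M)"
    by (rule bdd_aboveI2)
  then have "norm (T (e n)) \<le> norm (T x)" for n
    using cSUP_upper[of "e n" M "\<lambda>x. norm (T x) / norm x"] M(2,3) x(3) by (simp add: onorm_on_def)
  then have "c \<le> norm (T x)"
    using M(4) by (intro LIMSEQ_le_const2) auto
  then show False
    using M(5)[OF x(1,2)] by simp
qed

lemma AM_subset_essentially_isometric:
  "(AM :: ('a::chilbert_space \<Rightarrow>\<^sub>L 'b::chilbert_space) set) \<subseteq> essentially_isometric"
proof (rule subsetI, rule ccontr)
  fix T :: "'a \<Rightarrow>\<^sub>L 'b"
  assume T: "T \<in> AM" "T \<notin> essentially_isometric"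
  then have "T \<in> bounded_operators"
    by (simp add: AM_def)
  from this T(2) obtain M c e where M: "closed_csubspace M" "\<And>n::nat. e n \<in> M" "\<And>n. norm (e n) = 1"
    "(\<lambda>n. norm (T (e n))) \<longlonglongrightarrow> c" "\<And>x. x \<in> M \<Longrightarrow> norm x = 1 \<Longrightarrow> -1 * norm (T x) < -1 * c"
    by (rule unattained_subspace_exists[where \<sigma> = "-1"]) auto
  have "M \<noteq> {0}"
    using M(2,3) by (metis norm_zero singletonD zero_neq_one)
  then obtain x where x: "x \<in> M" "norm x = 1" "norm (T x) = min_modulus_on M T"
    using T M(1) unfolding AM_def minimum_attaining_on_def by blast
  have "bdd_below {norm (T x) |x. x \<in> M \<and> norm x = 1}"
    by (rule bdd_belowI[of _ 0]) auto
  then have "norm (T x) \<le> norm (T (e n))" for n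
    unfolding x(3) min_modulus_on_def using M(2,3) by (intro cInf_lower) auto
  then have "norm (T x) \<le> c"
    using M(4) by (intro LIMSEQ_le_const) auto
  then show False
    using M(5)[OF x(1,2)] by simp
qed

theorem theorem6p10:
  shows "closure (AN :: ('a::chilbert_space \<Rightarrow>\<^sub>L 'b::chilbert_space) set) = closure AM"
proof (rule antisym)
  \<comment> \<open>A class of essentially isometric operators has its closure inside that of
    \<open>Q\<close>, and \<open>Q\<close> lies in the other class.\<close>
  note subset = closure_minimal[OF order_trans[OF _ essentially_isometric_subset_closure] closed_closure]
  show "closure AN \<subseteq> closure (AM :: ('a \<Rightarrow>\<^sub>L 'b) set)"
    using subset[OF AN_subset_essentially_isometric]
      closure_mono[OF finite_codim_isometric_subset_AM] by blast
  show "closure AM \<subseteq> closure (AN :: ('a \<Rightarrow>\<^sub>L 'b) set)"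
    using subset[OF AM_subset_essentially_isometric]
      closure_mono[OF finite_codim_isometric_subset_AN] by blast
qed

end
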